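(* Let $G=G(n,p)$ be the binomial random graph on $n$ vertices, each edge present independently with probability $p=p(n)$. (1) If $p\ge (2\ln n+\omega(\ln\ln n))/n$, then with high probability $\mathrm{sp}^*(G,V(G))\le \lceil \log_2 n\rceil+1$. (2) If $p\le (\ln n-\omega(\ln\ln n))/n$, then with high probability $\mathrm{sp}(G,V(G))=\omega(\log n)$.
   Context: A path in a graph $G$ is a sequence of distinct vertices $v_0v_1\dots v_l$ ($l\ge 0$) with $v_{i-1}v_i\in E(G)$; it contains the vertices $v_0,\dots,v_l$. For a family $\mathcal F$ of paths in $G$ and a vertex $v$, let $\mathcal F(v)$ be the set of paths in $\mathcal F$ containing $v$. $\mathcal F$ separates $V(G)$ if $\mathcal F(u)\ne\mathcal F(v)$ for all distinct vertices $u,v$, and covers $V(G)$ if $\mathcal F(v)\neq\emptyset$ for every $v$. $\mathrm{sp}(G,V(G))$ is the minimum size of a family of paths separating $V(G)$ and $\mathrm{sp}^*(G,V(G))$ the minimum size of a family that separates and covers $V(G)$. "With high probability" means with probability tending to $1$ as $n\to\infty$. The hypothesis $p\ge(2\ln n+\omega(\ln\ln n))/n$ means $p\ge(2\ln n+f(n))/n$ for some function $f$ with $f(n)/\ln\ln n\to\infty$; similarly for the upper bound on $p$. *)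

theory Defs
  imports "HOL-Probability.Probability"
begin

text \<open>A simple graph is given by its vertex set \<open>V\<close> and its edge set \<open>E\<close>, whose elements
  are two-element subsets of \<open>V\<close>.\<close>

definition is_path :: "'a set \<Rightarrow> 'a set set \<Rightarrow> 'a list \<Rightarrow> bool" where
  "is_path V E xs \<longleftrightarrow>
     xs \<noteq> [] \<and> distinct xs \<and> set xs \<subseteq> V \<and> successively (\<lambda>u v. {u, v} \<in> E) xs"

definition containing :: "'a list set \<Rightarrow> 'a \<Rightarrow> 'a list set" where
  "containing F v = {P \<in> F. v \<in> set P}"

definition path_family :: "'a set \<Rightarrow> 'a set set \<Rightarrow> 'a list set \<Rightarrow> bool" where
  "path_family V E F \<longleftrightarrow> finite F \<and> (\<forall>P \<in> F. is_path V E P)"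

definition separates :: "'a list set \<Rightarrow> 'a set \<Rightarrow> bool" where
  "separates F V \<longleftrightarrow> (\<forall>u \<in> V. \<forall>v \<in> V. u \<noteq> v \<longrightarrow> containing F u \<noteq> containing F v)"

definition covers :: "'a list set \<Rightarrow> 'a set \<Rightarrow> bool" where
  "covers F V \<longleftrightarrow> (\<forall>v \<in> V. containing F v \<noteq> {})"

definition sp :: "'a set \<Rightarrow> 'a set set \<Rightarrow> nat" where
  "sp V E = (LEAST k. \<exists>F. path_family V E F \<and> separates F V \<and> card F = k)"

definition sp_star :: "'a set \<Rightarrow> 'a set set \<Rightarrow> nat" where
  "sp_star V E = (LEAST k. \<exists>F. path_family V E F \<and> separates F V \<and> covers F V \<and> card F = k)"

text \<open>Both minima are attained on finite graphs, since the one-vertex paths separate and cover.\<close>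

lemma ex_separating_covering_family:
  assumes "finite V"
  shows "\<exists>F. path_family V E F \<and> separates F V \<and> covers F V"
proof (intro exI conjI)
  let ?F = "(\<lambda>v. [v]) ` V"
  have c: "containing ?F v = {[v]}" if "v \<in> V" for v
    using that by (auto simp: containing_def)
  show "path_family V E ?F"
    using assms by (auto simp: path_family_def is_path_def)
  show "separates ?F V"
    by (simp add: separates_def c)
  show "covers ?F V"
    by (simp add: covers_def c)
qed

definition vertices :: "nat \<Rightarrow> nat set" where
  "vertices n = {..<n}"

definition all_pairs :: "nat \<Rightarrow> nat set set" where
  "all_pairs n = {e. e \<subseteq> vertices n \<and> card e = 2}"

text \<open>The distribution of the edge set of $G(n,p)$. Outside of \<open>all_pairs n\<close> the family of
  independent Bernoulli variables takes the default value \<open>False\<close>.\<close>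

definition gnp :: "nat \<Rightarrow> real \<Rightarrow> nat set set pmf" where
  "gnp n p = map_pmf (\<lambda>b. {e. b e}) (Pi_pmf (all_pairs n) False (\<lambda>_. bernoulli_pmf p))"

definition whp :: "(nat \<Rightarrow> 'a pmf) \<Rightarrow> (nat \<Rightarrow> 'a \<Rightarrow> bool) \<Rightarrow> bool" where
  "whp M Q \<longleftrightarrow> (\<lambda>n. measure_pmf.prob (M n) {x. Q n x}) \<longlonglongrightarrow> 1"

text \<open>A sequence that is $\omega(g)$ with positive sign; the library's \<open>\<omega>(g)\<close> constrains only
  absolute values.\<close>

definition dominates :: "(nat \<Rightarrow> real) \<Rightarrow> (nat \<Rightarrow> real) \<Rightarrow> bool" where
  "dominates f g \<longleftrightarrow> filterlim (\<lambda>n. f n / g n) at_top sequentially"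

end

theory Submission
  imports Defs "HOL-Real_Asymp.Real_Asymp"
begin

text \<open>For large \<open>p\<close> and \<open>k = \<lceil>log\<^sub>2 n\<rceil>\<close>, give the vertices distinct code words of length \<open>k\<close> such
  that each bit splits them into halves. A half spans a random graph on \<open>m \<approx> n / 2\<close> vertices with
  \<open>p \<ge> (ln m + \<omega>(ln ln m)) / m\<close>, which has a Hamiltonian path except with probability
  \<open>O(1 / (ln m)\<^sup>2)\<close>; so the \<open>k\<close> halves and the whole graph have one simultaneously, and these
  \<open>k + 1\<close> paths separate and cover. Hamiltonicity at this error rate is Posa's rotation
  argument: a first exposure is an expander, in which a longest path that is not spanning has
  quadratically many booster edges, and \<open>3 m\<close> rounds of sprinkling, each succeeding with
  probability at least \<open>3/4\<close>, hit \<open>m\<close> boosters.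

  For small \<open>p\<close>, an isolated vertex lies on no path but its own one-vertex path, so all isolated
  vertices except one need a path of their own, and a second moment computation shows that there are
  at least \<open>(ln n)\<^sup>3 / 4\<close> of them.\<close>

subsection \<open>Random subsets\<close>

text \<open>The ground set is arbitrary, so that one random graph can be studied on each of several
  vertex subsets at once: \<open>U\<close> stays the set of all pairs while \<open>V\<close>
  varies.\<close>

definition random_subset :: "'a set \<Rightarrow> real \<Rightarrow> 'a set pmf" where
  "random_subset U p = map_pmf (\<lambda>b. {e. b e}) (Pi_pmf U False (\<lambda>_. bernoulli_pmf p))"

lemma gnp_eq_random_subset: "gnp n p = random_subset (all_pairs n) p"
  by (simp add: gnp_def random_subset_def)

lemma set_random_subset: "finite U \<Longrightarrow> set_pmf (random_subset U p) \<subseteq> Pow U"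
  using set_Pi_pmf_subset[of U False] by (fastforce simp: random_subset_def)

lemma prob_cylinder:
  assumes "finite U" "A \<subseteq> U" "B \<subseteq> U" "A \<inter> B = {}" "0 \<le> p" "p \<le> 1"
  shows "measure_pmf.prob (random_subset U p) {E. A \<subseteq> E \<and> B \<inter> E = {}} = p ^ card A * (1 - p) ^ card B"
proof -
  define X where "X x = (if x \<in> A then {True} else if x \<in> B then {False} else UNIV)" for x
  have "measure_pmf.prob (random_subset U p) {E. A \<subseteq> E \<and> B \<inter> E = {}} =
      measure_pmf.prob (Pi_pmf U False (\<lambda>_. bernoulli_pmf p)) (Pi U X)"
    unfolding random_subset_def measure_map_pmf
    by (rule arg_cong[where f = "measure_pmf.prob _"])
      (use assms in \<open>auto simp: X_def Pi_def split: if_splits\<close>)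
  also have "\<dots> = (\<Prod>x\<in>U. measure_pmf.prob (bernoulli_pmf p) (X x))"
    by (rule measure_Pi_pmf_Pi) fact
  also have "\<dots> = (\<Prod>x\<in>U. (if x \<in> A then p else 1) * (if x \<in> B then 1 - p else 1))"
    using assms by (intro prod.cong) (auto simp: X_def measure_pmf_single)
  also have "\<dots> = p ^ card A * (1 - p) ^ card B"
    using assms by (simp add: prod.distrib prod.If_cases Int_absorb1 Int_absorb2)
  finally show ?thesis .
qed

section \<open>Multi-round exposure and monotonicity in the density\<close>

lemma bernoulli_or:
  assumes "0 \<le> p" "p \<le> 1" "0 \<le> q" "q \<le> 1"
  shows "bind_pmf (bernoulli_pmf p) (\<lambda>a. map_pmf (\<lambda>b. a \<or> b) (bernoulli_pmf q))
    = bernoulli_pmf (1 - (1 - p) * (1 - q))" (is "?l = ?r")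
proof (rule pmf_eqI)
  have r: "0 \<le> 1 - (1 - p) * (1 - q)" "1 - (1 - p) * (1 - q) \<le> 1"
    using assms mult_le_one[of "1 - p" "1 - q"] by auto
  have Not: "Collect Not = {False}" "Collect ((\<or>) False) = {True}" "Collect ((\<or>) True) = UNIV" by auto
  have F: "pmf ?l False = pmf ?r False"
    using assms r by (simp add: pmf_bind pmf_map measure_pmf_single vimage_def Not)
  have "pmf ?l True = pmf ?r True"
    using assms r by (simp add: pmf_bind pmf_map measure_pmf_single vimage_def Not algebra_simps)
  then show "pmf ?l b = pmf ?r b" for b using F by (cases b) auto
qed

text \<open>An element escapes the union exactly when both independent rounds miss it. This is what
  allows a random graph to be exposed in rounds, with conditioning on the earlier ones.\<close>

lemma random_subset_union:
  assumes "finite U" "0 \<le> p" "p \<le> 1" "0 \<le> q" "q \<le> 1"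
  shows "bind_pmf (random_subset U p) (\<lambda>A. map_pmf (\<lambda>B. A \<union> B) (random_subset U q))
    = random_subset U (1 - (1 - p) * (1 - q))" (is "?l = ?r")
proof -
  have "?r = map_pmf (\<lambda>b. {e. b e}) (Pi_pmf U False (\<lambda>_. bernoulli_pmf p) \<bind>
      (\<lambda>f. Pi_pmf U False (\<lambda>x. map_pmf (\<lambda>b. f x \<or> b) (bernoulli_pmf q))))"
    using assms unfolding random_subset_def bernoulli_or[OF assms(2-), symmetric]
    by (subst Pi_pmf_bind[where d' = False]) auto
  also have "\<dots> = map_pmf (\<lambda>b. {e. b e}) (Pi_pmf U False (\<lambda>_. bernoulli_pmf p) \<bind>
      (\<lambda>f. map_pmf (\<lambda>g x. f x \<or> g x) (Pi_pmf U False (\<lambda>x. bernoulli_pmf q))))"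
  proof (intro arg_cong[where f = "map_pmf _"] bind_pmf_cong refl)
    \<comment> \<open>Outside \<open>U\<close> both samples take the default \<open>False\<close>,
      and so does their disjunction; hence the product over \<open>U\<close> is determined pointwise
      everywhere.\<close>
    fix f assume f: "f \<in> set_pmf (Pi_pmf U False (\<lambda>_. bernoulli_pmf p))"
    then have f0: "f x = False" if "x \<notin> U" for x
      using set_Pi_pmf_subset[OF assms(1), of False] that by fastforce
    have "Pi_pmf U False (\<lambda>x. map_pmf (\<lambda>b. f x \<or> b) (bernoulli_pmf q))
      = Pi_pmf U False (\<lambda>x. bernoulli_pmf q \<bind> (\<lambda>b. return_pmf (f x \<or> b)))"
      by (simp add: map_pmf_def)
    also have "\<dots> = Pi_pmf U False (\<lambda>x. bernoulli_pmf q) \<bind>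
        (\<lambda>g. Pi_pmf U False (\<lambda>x. return_pmf (f x \<or> g x)))"
      using assms by (subst Pi_pmf_bind[where d' = False]) auto
    also have "\<dots> = Pi_pmf U False (\<lambda>x. bernoulli_pmf q) \<bind> (\<lambda>g. return_pmf (\<lambda>x. f x \<or> g x))"
    proof (intro bind_pmf_cong refl)
      fix g assume "g \<in> set_pmf (Pi_pmf U False (\<lambda>_. bernoulli_pmf q))"
      then have "g x = False" if "x \<notin> U" for x
        using set_Pi_pmf_subset[OF assms(1), of False] that by fastforce
      then show "Pi_pmf U False (\<lambda>x. return_pmf (f x \<or> g x)) = return_pmf (\<lambda>x. f x \<or> g x)"
        using assms f0 by (subst Pi_pmf_return_pmf) (auto intro!: arg_cong[where f = return_pmf])
    qed
    finally show "Pi_pmf U False (\<lambda>x. map_pmf (\<lambda>b. f x \<or> b) (bernoulli_pmf q))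
      = map_pmf (\<lambda>g x. f x \<or> g x) (Pi_pmf U False (\<lambda>x. bernoulli_pmf q))"
      by (simp add: map_pmf_def)
  qed
  also have "\<dots> = ?l"
    unfolding random_subset_def map_bind_pmf bind_map_pmf map_pmf_comp
    by (intro bind_pmf_cong map_pmf_cong refl) auto
  finally show ?thesis by simp
qed

lemma prob_random_subset_union:
  assumes U: "finite U" "0 \<le> p" "p \<le> 1" "0 \<le> q" "q \<le> 1"
  shows "measure_pmf.prob (random_subset U (1 - (1 - p) * (1 - q))) X
    = measure_pmf.expectation (random_subset U p)
        (\<lambda>A. measure_pmf.prob (random_subset U q) {B. A \<union> B \<in> X})"
  unfolding random_subset_union[OF assms, symmetric] measure_pmf_bind
  by (subst measure_pmf.measure_bind[where N = "count_space UNIV"])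
    (auto simp: vimage_def measure_pmf_in_subprob_algebra intro!: measurable_measure_pmf)

text \<open>Conditioning on the first round \<open>A\<close>: the failure probability of the second
  round is at most \<open>\<delta>\<close> for a good \<open>A\<close> and at most
  \<open>\<epsilon>\<close> otherwise, hence at most
  \<open>\<epsilon> * indicator Bad A + \<delta>\<close> in every case.\<close>

lemma prob_union_le:
  assumes U: "finite U" "0 \<le> p" "p \<le> 1" "0 \<le> q" "q \<le> 1" and "0 \<le> \<delta>" "0 \<le> \<epsilon>"
    and good: "\<And>A. A \<subseteq> U \<Longrightarrow> A \<notin> Bad \<Longrightarrow> measure_pmf.prob (random_subset U q) {B. A \<union> B \<in> X} \<le> \<delta>"
    and bad: "\<And>A. A \<subseteq> U \<Longrightarrow> measure_pmf.prob (random_subset U q) {B. A \<union> B \<in> X} \<le> \<epsilon>"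
  shows "measure_pmf.prob (random_subset U (1 - (1 - p) * (1 - q))) X
    \<le> \<epsilon> * measure_pmf.prob (random_subset U p) Bad + \<delta>"
proof -
  let ?M = "random_subset U p"
  have fin: "finite (set_pmf ?M)"
    using set_random_subset[OF U(1)] U(1) by (meson finite_Pow_iff finite_subset)
  have "measure_pmf.expectation ?M (\<lambda>A. measure_pmf.prob (random_subset U q) {B. A \<union> B \<in> X})
      \<le> measure_pmf.expectation ?M (\<lambda>A. \<epsilon> * indicator Bad A + \<delta>)"
  proof (intro integral_mono_AE)
    show "AE A in ?M. measure_pmf.prob (random_subset U q) {B. A \<union> B \<in> X} \<le> \<epsilon> * indicator Bad A + \<delta>"
      unfolding AE_measure_pmf_iff
    proof
      fix A assume "A \<in> set_pmf ?M"
      then have "A \<subseteq> U" using set_random_subset[OF U(1)] by blast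
      then show "measure_pmf.prob (random_subset U q) {B. A \<union> B \<in> X} \<le> \<epsilon> * indicator Bad A + \<delta>"
        using good[of A] bad[of A] \<open>0 \<le> \<delta>\<close> by (cases "A \<in> Bad") auto
    qed
  qed (use fin in \<open>auto intro!: integrable_measure_pmf_finite\<close>)
  also have "\<dots> = \<epsilon> * measure_pmf.prob ?M Bad + \<delta>"
    using fin by (simp add: integrable_measure_pmf_finite)
  finally show ?thesis by (simp add: prob_random_subset_union[OF U])
qed

text \<open>It is the complement of \<open>X\<close> that is closed under adding elements of
  \<open>U\<close>, so \<open>X\<close> is a decreasing property. Coupling by a second round of
  exposure shows that it becomes less likely as the density grows.\<close>

lemma prob_upward_closed_mono:
  assumes "finite U" "0 \<le> p" "p \<le> p'" "p' \<le> 1" "\<And>A B. A \<notin> X \<Longrightarrow> A \<subseteq> B \<Longrightarrow> B \<subseteq> U \<Longrightarrow> B \<notin> X"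
  shows "measure_pmf.prob (random_subset U p') X \<le> measure_pmf.prob (random_subset U p) X"
proof (cases "p = 1")
  case False
  \<comment> \<open>The second-round density that makes two rounds amount to \<open>p'\<close>. The
    excluded case \<open>p = 1\<close> forces \<open>p' = 1\<close>.\<close>
  define q where "q = (p' - p) / (1 - p)"
  have q: "0 \<le> q" "q \<le> 1" "p' = 1 - (1 - p) * (1 - q)"
    using assms False by (auto simp: q_def field_simps)
  have "measure_pmf.prob (random_subset U q) {B. A \<union> B \<in> X} = 0" if "A \<subseteq> U" "A \<notin> X" for A
  proof -
    have "{B. A \<union> B \<in> X} \<inter> set_pmf (random_subset U q) = {}"
      using assms(5)[OF that(2)] that(1) set_random_subset[OF assms(1), of q] by blast
    then show ?thesis by (auto simp: measure_pmf_zero_iff)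
  qed
  then show ?thesis
    using prob_union_le[of U p q 0 1 X X] assms q by auto
qed (use assms in auto)

subsection \<open>Rotations and boosters\<close>

definition pairs :: "'a set \<Rightarrow> 'a set set" where
  "pairs V = {e. e \<subseteq> V \<and> card e = 2}"

definition nbhd :: "'a set \<Rightarrow> 'a set set \<Rightarrow> 'a set \<Rightarrow> 'a set" where
  "nbhd V E S = {v \<in> V - S. \<exists>u\<in>S. {u, v} \<in> E}"

text \<open>The factor 2 matches Posa's argument, where a set of endpoints has fewer than twice its
  size in neighbours. The restriction to a quarter of \<open>V\<close> keeps at least a quarter of
  the vertices outside \<open>S\<close> and a too small neighbourhood of it, which makes the union
  bound work.\<close>

definition expander :: "'a set \<Rightarrow> 'a set set \<Rightarrow> bool" where
  "expander V E \<longleftrightarrow> (\<forall>S\<subseteq>V. S \<noteq> {} \<longrightarrow> 4 * card S \<le> card V \<longrightarrow> 2 * card S \<le> card (nbhd V E S))"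

definition longest_path :: "'a set \<Rightarrow> 'a set set \<Rightarrow> 'a list \<Rightarrow> bool" where
  "longest_path V E P \<longleftrightarrow> is_path V E P \<and> (\<forall>Q. is_path V E Q \<longrightarrow> length Q \<le> length P)"

text \<open>Unordered edges make adjacency on a path invariant under reversal and easy to compare
  before and after a rotation.\<close>

fun path_edges :: "'a list \<Rightarrow> 'a set set" where
  "path_edges (x # y # zs) = insert {x, y} (path_edges (y # zs))"
| "path_edges _ = {}"

lemma is_path_iff_path_edges:
  "is_path V E xs \<longleftrightarrow> xs \<noteq> [] \<and> distinct xs \<and> set xs \<subseteq> V \<and> path_edges xs \<subseteq> E"
proof -
  have "successively (\<lambda>u v. {u, v} \<in> E) xs \<longleftrightarrow> path_edges xs \<subseteq> E"
    by (induction xs rule: path_edges.induct) auto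
  then show ?thesis by (auto simp: is_path_def)
qed

lemma path_edges_append:
  "xs \<noteq> [] \<Longrightarrow> ys \<noteq> [] \<Longrightarrow>
    path_edges (xs @ ys) = path_edges xs \<union> {{last xs, hd ys}} \<union> path_edges ys"
proof (induction xs rule: path_edges.induct)
  case ("2_2" x)
  then show ?case by (cases ys) auto
qed auto

lemma path_edges_rev [simp]: "path_edges (rev xs) = path_edges xs"
proof (induction xs)
  case (Cons x xs)
  show ?case
  proof (cases xs)
    case (Cons y ys)
    then have "path_edges (rev (x # xs)) = path_edges (rev xs) \<union> {{y, x}}"
      using path_edges_append[of "rev xs" "[x]"] by (simp add: last_rev)
    then show ?thesis using Cons.IH Cons by (simp add: insert_commute[of y x])
  qed simp
qed simp

lemma path_edges_nthE:
  assumes "e \<in> path_edges P"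
  obtains i where "Suc i < length P" "e = {P ! i, P ! Suc i}"
proof -
  have "\<exists>i. Suc i < length P \<and> e = {P ! i, P ! Suc i}"
    using assms
  proof (induction P rule: path_edges.induct)
    case (1 x y zs)
    show ?case
    proof (cases "e = {x, y}")
      case False
      then obtain i where "Suc i < length (y # zs)" "e = {(y # zs) ! i, (y # zs) ! Suc i}"
        using 1 by auto
      then show ?thesis by (intro exI[of _ "Suc i"]) simp
    qed (simp add: exI[of _ 0])
  qed simp_all
  then show thesis using that by blast
qed

lemma is_path_mono: "is_path V E xs \<Longrightarrow> E \<subseteq> E' \<Longrightarrow> is_path V E' xs"
  by (auto simp: is_path_iff_path_edges)

lemma expander_mono:
  assumes "finite V" "expander V E" "E \<subseteq> E'"
  shows "expander V E'"
  unfolding expander_def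
proof (intro allI impI)
  fix S assume S: "S \<subseteq> V" "S \<noteq> {}" "4 * card S \<le> card V"
  have "nbhd V E S \<subseteq> nbhd V E' S" using assms(3) by (auto simp: nbhd_def)
  then have "card (nbhd V E S) \<le> card (nbhd V E' S)"
    using assms(1) by (intro card_mono) (auto simp: nbhd_def)
  moreover have "2 * card S \<le> card (nbhd V E S)" using assms(2) S unfolding expander_def by blast
  ultimately show "2 * card S \<le> card (nbhd V E' S)" by simp
qed

section \<open>Posa rotations and the set of endpoints they reach\<close>

text \<open>Posa's rotation with fixed first vertex and pivot \<open>u\<close>: the edge from the
  last vertex back to \<open>u\<close> replaces the edge from \<open>u\<close> to its successor, and
  that successor becomes the new last vertex.\<close>

inductive rotation :: "'a set set \<Rightarrow> 'a list \<Rightarrow> 'a list \<Rightarrow> bool" for E P where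
  rotation_refl: "rotation E P P"
| rotation_step: "rotation E P (xs @ u # ys) \<Longrightarrow> ys \<noteq> [] \<Longrightarrow> {last ys, u} \<in> E \<Longrightarrow>
    rotation E P (xs @ u # rev ys)"

definition endpoints :: "'a set set \<Rightarrow> 'a list \<Rightarrow> 'a set" where
  "endpoints E P = {last Q |Q. rotation E P Q}"

lemma endpointsI: "rotation E P Q \<Longrightarrow> last Q = x \<Longrightarrow> x \<in> endpoints E P"
  unfolding endpoints_def by blast

lemma path_edges_snoc_append:
  "ys \<noteq> [] \<Longrightarrow> path_edges (xs @ u # ys) = path_edges (xs @ [u]) \<union> {{u, hd ys}} \<union> path_edges ys"
  using path_edges_append[of "xs @ [u]" ys] by simp

lemma rotation_is_path:
  assumes "rotation E P Q" "is_path V E P"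
  shows "is_path V E Q \<and> length Q = length P \<and> hd Q = hd P \<and> set Q = set P"
  using assms
proof (induction rule: rotation.induct)
  case (rotation_step xs u ys)
  then have "path_edges (xs @ u # rev ys) \<subseteq> E"
    using path_edges_snoc_append[of ys xs u] path_edges_snoc_append[of "rev ys" xs u]
    by (auto simp: is_path_iff_path_edges hd_rev insert_commute)
  moreover have "hd (xs @ u # rev ys) = hd (xs @ u # ys)" by (cases xs) auto
  ultimately show ?case using rotation_step by (auto simp: is_path_iff_path_edges)
qed auto

text \<open>A rotation changes adjacency on the path only at the pivot and at the old and new last
  vertices. The last two are endpoints, and the pivot was next to the new endpoint, so a vertex that
  is neither an endpoint nor next to one in \<open>P\<close> keeps its path neighbours
  forever.\<close>

lemma rotation_path_edges:
  assumes "rotation E P Q" "u \<notin> endpoints E P" "\<And>w. {u, w} \<in> path_edges P \<Longrightarrow> w \<notin> endpoints E P"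
  shows "{u, w} \<in> path_edges Q \<longleftrightarrow> {u, w} \<in> path_edges P"
  using assms(1)
proof (induction arbitrary: w rule: rotation.induct)
  case (rotation_step xs u0 ys)
  have l: "last ys \<in> endpoints E P" "hd ys \<in> endpoints E P"
    using endpointsI[OF rotation_step(1)] endpointsI[OF rotation.rotation_step[OF rotation_step(1-3)]]
      rotation_step(2) by (simp_all add: last_rev)
  have Q: "path_edges (xs @ u0 # ys) = path_edges (xs @ [u0]) \<union> {{u0, hd ys}} \<union> path_edges ys"
    "path_edges (xs @ u0 # rev ys) = path_edges (xs @ [u0]) \<union> {{u0, last ys}} \<union> path_edges ys"
    using rotation_step(2) path_edges_snoc_append[of ys xs u0] path_edges_snoc_append[of "rev ys" xs u0]
    by (auto simp: hd_rev)
  \<comment> \<open>A pivot \<open>u\<close> would be next to the endpoint \<open>hd ys\<close> on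
    the current path, hence by induction already on \<open>P\<close>.\<close>
  have "u \<noteq> u0"
    using rotation_step.IH[of "hd ys"] assms(3)[of "hd ys"] l Q by auto
  moreover have "u \<noteq> last ys" "u \<noteq> hd ys" using l assms(2) by auto
  ultimately show ?case using rotation_step.IH[of w] Q by (auto simp: doubleton_eq_iff)
qed auto

lemma longest_path_rotation: "rotation E P Q \<Longrightarrow> longest_path V E P \<Longrightarrow> longest_path V E Q"
  using rotation_is_path[of E P Q V] by (auto simp: longest_path_def)

lemma endpoints_subset: "is_path V E P \<Longrightarrow> endpoints E P \<subseteq> set P"
proof
  fix x assume P: "is_path V E P" and "x \<in> endpoints E P"
  then obtain Q where Q: "rotation E P Q" "x = last Q" by (auto simp: endpoints_def)
  from rotation_is_path[OF Q(1) P] show "x \<in> set P" using Q(2) last_in_set[of Q]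
    by (auto simp: is_path_def)
qed

text \<open>Posa's lemma. A neighbour \<open>u\<close> of an endpoint \<open>last Q\<close> lies on
  \<open>Q\<close>, as otherwise \<open>Q\<close> could be prolonged. Rotating at \<open>u\<close>
  makes its successor on \<open>Q\<close> an endpoint. If \<open>u\<close> were next to no endpoint
  in \<open>P\<close>, its path neighbours in \<open>Q\<close> would be those in \<open>P\<close>,
  and that successor is one of them.\<close>

lemma nbhd_endpoints:
  assumes P: "longest_path V E P"
  shows "nbhd V E (endpoints E P) \<subseteq> {u. \<exists>w\<in>endpoints E P. {u, w} \<in> path_edges P}"
proof
  fix u assume u: "u \<in> nbhd V E (endpoints E P)"
  then obtain Q where Q: "rotation E P Q" "{last Q, u} \<in> E" "u \<in> V" "u \<notin> endpoints E P"
    by (auto simp: nbhd_def endpoints_def)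
  have L: "longest_path V E Q" by (rule longest_path_rotation[OF Q(1) P])
  then have pQ: "is_path V E Q" "Q \<noteq> []" by (auto simp: longest_path_def is_path_def)
  have "u \<in> set Q"
  proof (rule ccontr)
    assume "u \<notin> set Q"
    then have "is_path V E (Q @ [u])"
      using pQ Q path_edges_append[of Q "[u]"] by (auto simp: is_path_iff_path_edges)
    then show False using L by (auto simp: longest_path_def)
  qed
  then obtain xs ys where Qs: "Q = xs @ u # ys" by (meson split_list)
  have "last Q \<noteq> u" using Q by (auto simp: endpoints_def)
  then have ys: "ys \<noteq> []" "last Q = last ys" using Qs by auto
  have "rotation E P (xs @ u # rev ys)" using Q ys Qs by (intro rotation_step) auto
  then have w: "hd ys \<in> endpoints E P"
    using ys by (intro endpointsI) (auto simp: last_rev)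
  have "{u, hd ys} \<in> path_edges Q" using path_edges_snoc_append[OF ys(1)] Qs by auto
  then show "u \<in> {u. \<exists>w\<in>endpoints E P. {u, w} \<in> path_edges P}"
    using rotation_path_edges[OF Q(1,4), of "hd ys"] w by auto
qed

text \<open>Every vertex has at most two neighbours on the path, and the last vertex has at most
  one, which makes the inequality strict.\<close>

lemma card_path_neighbours:
  assumes "distinct P" "P \<noteq> []" "R \<subseteq> set P" "last P \<in> R"
  shows "card {u. \<exists>w\<in>R. {u, w} \<in> path_edges P} < 2 * card R"
proof -
  define I where "I = {i. i < length P \<and> P ! i \<in> R}"
  define n where "n = length P - 1"
  have finI: "finite I" by (auto simp: I_def)
  have "R = (!) P ` I"
  proof (intro equalityI subsetI)
    fix x assume "x \<in> R"
    moreover then obtain i where "i < length P" "x = P ! i" using assms(3) by (metis in_mono in_set_conv_nth)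
    ultimately show "x \<in> (!) P ` I" by (auto simp: I_def)
  qed (auto simp: I_def)
  moreover have "inj_on ((!) P) I" using assms(1) by (auto simp: inj_on_def I_def nth_eq_iff_index_eq)
  ultimately have cI: "card I = card R" by (metis card_image)
  have n: "n \<in> I" using assms by (auto simp: I_def n_def last_conv_nth)
  \<comment> \<open>Neighbours sit one position after or before a position in \<open>I\<close>, and
    the last position \<open>n\<close> has none after it. Truncated subtraction sends 0 to 0, which
    only enlarges the right-hand side.\<close>
  have "{u. \<exists>w\<in>R. {u, w} \<in> path_edges P} \<subseteq> (!) P ` (Suc ` (I - {n}) \<union> (\<lambda>i. i - 1) ` I)"
  proof
    fix u assume "u \<in> {u. \<exists>w\<in>R. {u, w} \<in> path_edges P}"
    then obtain w i where w: "w \<in> R" "{u, w} = {P ! i, P ! Suc i}" "Suc i < length P"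
      by (auto elim: path_edges_nthE)
    then consider "u = P ! i" "w = P ! Suc i" | "u = P ! Suc i" "w = P ! i"
      by (auto simp: doubleton_eq_iff)
    then show "u \<in> (!) P ` (Suc ` (I - {n}) \<union> (\<lambda>i. i - 1) ` I)"
    proof cases
      case 1
      then have "Suc i \<in> I" using w by (auto simp: I_def)
      then have "i \<in> (\<lambda>i. i - 1) ` I" by force
      then show ?thesis using 1 by auto
    next
      case 2
      then have "i \<in> I - {n}" using w by (auto simp: I_def n_def)
      then show ?thesis using 2 by auto
    qed
  qed
  then have "card {u. \<exists>w\<in>R. {u, w} \<in> path_edges P} \<le> card ((!) P ` (Suc ` (I - {n}) \<union> (\<lambda>i. i - 1) ` I))"
    using finI by (intro card_mono) auto
  also have "\<dots> \<le> card (Suc ` (I - {n}) \<union> (\<lambda>i. i - 1) ` I)" using finI by (intro card_image_le) auto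
  also have "\<dots> \<le> card (Suc ` (I - {n})) + card ((\<lambda>i. i - 1) ` I)" by (rule card_Un_le)
  also have "\<dots> \<le> card (I - {n}) + card I" using finI by (intro add_mono card_image_le) auto
  also have "\<dots> < 2 * card R"
    using n finI cI by (metis add_strict_right_mono card_Diff1_less mult_2)
  finally show ?thesis .
qed

text \<open>If the endpoints made up at most a quarter of \<open>V\<close>, expansion would give
  them at least \<open>2 * card (endpoints E P)\<close> neighbours, but by Posa's lemma all of these
  are path neighbours of endpoints, of which there are fewer.\<close>

lemma card_endpoints:
  assumes V: "finite V" and ex: "expander V E" and P: "longest_path V E P"
  shows "card V < 4 * card (endpoints E P)"
proof (rule ccontr)
  let ?R = "endpoints E P"
  assume "\<not> ?thesis"
  then have le: "4 * card ?R \<le> card V" by simp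
  have iP: "is_path V E P" using P by (simp add: longest_path_def)
  have R: "?R \<subseteq> set P" "last P \<in> ?R"
    using endpoints_subset[OF iP] rotation_refl[of E P] by (auto simp: endpoints_def)
  have "2 * card ?R \<le> card (nbhd V E ?R)"
    using ex le R iP unfolding expander_def is_path_def by blast
  also have "\<dots> \<le> card {u. \<exists>w\<in>?R. {u, w} \<in> path_edges P}"
  proof (rule card_mono[OF _ nbhd_endpoints[OF P]])
    have "{u. \<exists>w\<in>?R. {u, w} \<in> path_edges P} \<subseteq> \<Union> (path_edges P)" by auto
    moreover have "path_edges Q \<subseteq> Pow (set Q)" for Q :: "'a list"
      by (induction Q rule: path_edges.induct) auto
    then have "finite (\<Union> (path_edges P))" by (meson Sup_le_iff PowD finite_set finite_subset subsetD)
    ultimately show "finite {u. \<exists>w\<in>?R. {u, w} \<in> path_edges P}" by (rule finite_subset)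
  qed
  also have "\<dots> < 2 * card ?R"
    using iP R by (intro card_path_neighbours) (auto simp: is_path_def)
  finally show False by simp
qed

section \<open>Connectivity of expanders and boosters of a longest path\<close>

text \<open>Expanders are connected. Without a crossing edge, the smaller side \<open>X\<close> of
  the cut would contain the neighbourhoods of all its subsets, leaving too little room for a subset
  of size \<open>k\<close> to expand.\<close>

lemma expander_crossing_edge:
  assumes V: "finite V" "8 \<le> card V" and ex: "expander V E" and W: "W \<subseteq> V" "W \<noteq> {}" "W \<noteq> V"
  shows "\<exists>w\<in>W. \<exists>z\<in>V - W. {w, z} \<in> E"
proof (rule ccontr)
  assume no: "\<not> ?thesis"
  define X where "X = (if 2 * card W \<le> card V then W else V - W)"
  have "card (V - W) = card V - card W" using V W by (metis card_Diff_subset finite_subset)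
  then have X: "X \<subseteq> V" "X \<noteq> {}" "2 * card X \<le> card V"
    using W by (auto simp: X_def)
  have cl: "nbhd V E S \<subseteq> X - S" if "S \<subseteq> X" for S
    using no that X by (fastforce simp: nbhd_def X_def insert_commute split: if_splits)
  have fX: "finite X" using X V finite_subset by blast
  define k where "k = min (card X) (card V div 4)"
  have cX: "card X > 0" using X fX by (simp add: card_gt_0_iff)
  have k: "k > 0" "k \<le> card X" "4 * k \<le> card V" using cX V by (auto simp: k_def)
  then obtain S where S: "S \<subseteq> X" "card S = k" by (meson obtain_subset_with_card_n)
  have fS: "finite S" using S fX finite_subset by blast
  have "S \<noteq> {}" "S \<subseteq> V" using S k X by auto
  then have "2 * k \<le> card (nbhd V E S)" using ex S(2) k(3) unfolding expander_def by blast
  also have "\<dots> \<le> card (X - S)" using cl[OF S(1)] fX by (intro card_mono) auto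
  also have "\<dots> = card X - k" using S fS by (simp add: card_Diff_subset)
  finally have "3 * k \<le> card X" using k by linarith
  \<comment> \<open>The first alternative contradicts \<open>X \<noteq> {}\<close>. The second
    contradicts \<open>2 * card X \<le> card V\<close>, because the quarter rounded down is at least
    2; this is where \<open>8 \<le> card V\<close> enters.\<close>
  then have "3 * card X \<le> card X \<or> 3 * (card V div 4) \<le> card X" by (cases "card X \<le> card V div 4") (simp_all add: k_def min_def)
  moreover have "card V < 4 * (card V div 4) + 4" by simp
  moreover have "2 \<le> card V div 4" using div_le_mono[OF V(2), of 4] by simp
  ultimately show False using X(3) cX V(2) by linarith
qed

text \<open>Joining the two ends of \<open>Q\<close> gives a cycle. By connectivity some
  \<open>w\<close> on it has a neighbour \<open>z\<close> outside, and cutting the cycle open at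
  \<open>w\<close> and starting from \<open>z\<close> gives a path with one more vertex.\<close>

lemma closing_edge_extends:
  assumes V: "finite V" "8 \<le> card V" and ex: "expander V E"
    and Q: "is_path V E Q" "length Q < card V"
  shows "\<exists>Q'. is_path V (insert {hd Q, last Q} E) Q' \<and> length Q' > length Q"
proof -
  have "set Q \<subseteq> V" "set Q \<noteq> {}" "set Q \<noteq> V"
    using Q distinct_card[of Q] by (auto simp: is_path_def)
  from expander_crossing_edge[OF V ex this] obtain w z where
    w: "w \<in> set Q" "z \<in> V - set Q" "{w, z} \<in> E" by auto
  then obtain xs ys where Qs: "Q = xs @ w # ys" by (meson split_list)
  have pQ: "path_edges Q \<subseteq> E" using Q by (simp add: is_path_iff_path_edges)
  have zw: "{z, w} \<in> E" using w(3) by (simp add: insert_commute)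
  have "path_edges (z # (w # ys) @ xs) \<subseteq> insert {hd Q, last Q} E"
  \<comment> \<open>When \<open>w\<close> is the first vertex of \<open>Q\<close>, the new path is
    \<open>z\<close> followed by \<open>Q\<close>; otherwise it runs from \<open>w\<close> to the
    end of \<open>Q\<close>, over the closing edge and through \<open>xs\<close>.\<close>
  proof (cases "xs = []")
    case True
    then have "path_edges (z # (w # ys) @ xs) = insert {z, w} (path_edges Q)" using Qs by simp
    then show ?thesis using pQ zw by (simp add: subset_insertI2)
  next
    case False
    have "path_edges (z # (w # ys) @ xs)
        = insert {z, w} (path_edges (w # ys) \<union> {{last Q, hd Q}} \<union> path_edges xs)"
      using path_edges_append[of "w # ys" xs] False Qs by simp
    moreover have "path_edges (w # ys) \<union> path_edges xs \<subseteq> path_edges Q"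
      unfolding Qs using path_edges_append[of xs "w # ys"] False by blast
    moreover have "{last Q, hd Q} = {hd Q, last Q}" by (rule insert_commute)
    ultimately show ?thesis using pQ zw by (simp add: subset_insertI2 order_trans[OF _ pQ])
  qed
  then have "is_path V (insert {hd Q, last Q} E) (z # (w # ys) @ xs)"
    using Q Qs w by (auto simp: is_path_iff_path_edges)
  then show ?thesis using Qs by (intro exI[of _ "z # (w # ys) @ xs"]) auto
qed

lemma card_le_twice_card_doubletons:
  assumes "finite D"
  shows "card D \<le> 2 * card ((\<lambda>(b, c). {b, c}) ` D)"
proof -
  let ?f = "\<lambda>(b, c). {b, c}"
  have fibre: "card {d \<in> D. ?f d = e} \<le> 2" if "e \<in> ?f ` D" for e
  proof -
    from that obtain d0 where d0: "e = ?f d0" by (rule imageE)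
    have "{d \<in> D. ?f d = e} \<subseteq> {d0, prod.swap d0}"
    proof
      fix d assume "d \<in> {d \<in> D. ?f d = e}"
      then have "{fst d, snd d} = {fst d0, snd d0}" using d0 by (simp add: case_prod_beta)
      then have "d = d0 \<or> d = prod.swap d0" unfolding doubleton_eq_iff by (metis prod_eq_iff fst_swap snd_swap)
      then show "d \<in> {d0, prod.swap d0}" by blast
    qed
    then have "card {d \<in> D. ?f d = e} \<le> card {d0, prod.swap d0}" by (rule card_mono[rotated]) simp
    also have "\<dots> \<le> 2" by (cases "d0 = prod.swap d0") simp_all
    finally show ?thesis .
  qed
  have "card D = (\<Sum>e\<in>?f ` D. card {d \<in> D. ?f d = e})"
    using sum.image_gen[OF assms, of "\<lambda>_. 1::nat" ?f] unfolding card_eq_sum .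
  also have "\<dots> \<le> (\<Sum>e\<in>?f ` D. 2)" by (rule sum_mono) (rule fibre)
  finally show ?thesis by simp
qed

text \<open>Rotations reach more than a quarter of \<open>V\<close> as last vertices
  \<open>b\<close>. Reversing each resulting path fixes \<open>b\<close> as first vertex, and
  rotating again reaches more than a quarter of \<open>V\<close> as opposite ends. This gives at
  least 1/16 of all ordered pairs, and at least half that number of edges, each joining the ends of
  a longest path.\<close>

lemma many_boosters:
  assumes V: "finite V" "8 \<le> card V" and ex: "expander V E"
    and P: "longest_path V E P" "length P < card V"
  shows "\<exists>B\<subseteq>pairs V. (card V)\<^sup>2 \<le> 32 * card B \<and>
    (\<forall>e\<in>B. \<exists>Q. is_path V (insert e E) Q \<and> length Q > length P)"
proof -
  define D where "D = {(hd Q, last Q) |Q. is_path V E Q \<and> length Q = length P}"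
  define B where "B = (\<lambda>(b, c). {b, c}) ` D"
  have iP: "is_path V E P" using P by (simp add: longest_path_def)
  have fR: "finite (endpoints E Q)" if "is_path V E Q" for Q
    using endpoints_subset[OF that] finite_subset by blast
  \<comment> \<open>Two vertices on the path make its ends distinct, so that the boosters are
    genuine pairs in \<open>pairs V\<close>.\<close>
  have len2: "length P \<ge> 2"
  proof -
    have "card (endpoints E P) \<le> card (set P)" using endpoints_subset[OF iP] by (simp add: card_mono)
    also have "\<dots> \<le> length P" by (rule card_length)
    finally show ?thesis using card_endpoints[OF V(1) ex P(1)] V by linarith
  qed
  have DV: "D \<subseteq> V \<times> V" by (auto simp: D_def is_path_def intro: hd_in_set last_in_set)
  then have fD: "finite D" using V finite_subset by blast
  have "card V * card V \<le> 16 * card D"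
  proof -
    define S where "S = Sigma (endpoints E P) (\<lambda>b. {c. (b, c) \<in> D})"
    have row: "card V \<le> 4 * card {c. (b, c) \<in> D}" if b: "b \<in> endpoints E P" for b
    proof -
      from b obtain Q where Q: "rotation E P Q" "b = last Q" by (auto simp: endpoints_def)
      have LQ: "longest_path V E Q" by (rule longest_path_rotation[OF Q(1) P(1)])
      then have LQ': "longest_path V E (rev Q)"
        by (auto simp: longest_path_def is_path_iff_path_edges)
      have lenQ: "length Q = length P" "Q \<noteq> []" using rotation_is_path[OF Q(1) iP] by (auto simp: is_path_def)
      have "endpoints E (rev Q) \<subseteq> {c. (b, c) \<in> D}"
      proof
        fix c assume "c \<in> endpoints E (rev Q)"
        then obtain Q' where Q': "rotation E (rev Q) Q'" "c = last Q'" by (auto simp: endpoints_def)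
        have "is_path V E (rev Q)" using LQ' by (simp add: longest_path_def)
        from rotation_is_path[OF Q'(1) this]
        have "is_path V E Q'" "length Q' = length P" "b = hd Q'"
          using Q(2) lenQ by (simp_all add: hd_rev)
        then have "(b, c) = (hd Q', last Q') \<and> is_path V E Q' \<and> length Q' = length P"
          using Q'(2) by simp
        then show "c \<in> {c. (b, c) \<in> D}" unfolding D_def mem_Collect_eq by (rule exI)
      qed
      moreover have "finite {c. (b, c) \<in> D}" using DV V by (auto intro: finite_subset[of _ V])
      ultimately have "card (endpoints E (rev Q)) \<le> card {c. (b, c) \<in> D}" by (rule card_mono[rotated])
      then show ?thesis using card_endpoints[OF V(1) ex LQ'] by linarith
    qed
    have "card V * card V \<le> 4 * card (endpoints E P) * card V"
      using card_endpoints[OF V(1) ex P(1)] by (intro mult_right_mono) auto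
    also have "\<dots> = 4 * (\<Sum>b\<in>endpoints E P. card V)" by simp
    also have "\<dots> \<le> 4 * (\<Sum>b\<in>endpoints E P. 4 * card {c. (b, c) \<in> D})"
      by (intro mult_left_mono sum_mono row) auto
    also have "\<dots> = 16 * card S"
      unfolding S_def using fR[OF iP] DV V
      by (subst card_SigmaI) (auto simp: sum_distrib_left intro: finite_subset[of _ V])
    also have "\<dots> \<le> 16 * card D"
      using fD by (intro mult_left_mono card_mono) (auto simp: S_def)
    finally show ?thesis .
  qed
  moreover have "card D \<le> 2 * card B" unfolding B_def by (rule card_le_twice_card_doubletons[OF fD])
  ultimately have "(card V)\<^sup>2 \<le> 32 * card B" by (simp add: power2_eq_square)
  moreover have "B \<subseteq> pairs V"
  proof
    fix e assume "e \<in> B"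
    then obtain Q where Q: "e = {hd Q, last Q}" "is_path V E Q" "length Q = length P"
      by (auto simp: B_def D_def)
    have "length Q \<ge> 2" "distinct Q" using Q len2 by (simp_all add: is_path_def)
    then have "hd Q \<noteq> last Q" by (cases Q) auto
    moreover have "hd Q \<in> V" "last Q \<in> V" using Q by (auto simp: is_path_def)
    ultimately show "e \<in> pairs V" using Q by (auto simp: pairs_def)
  qed
  moreover have "\<forall>e\<in>B. \<exists>Q. is_path V (insert e E) Q \<and> length Q > length P"
  proof
    fix e assume "e \<in> B"
    then obtain Q where Q: "e = {hd Q, last Q}" "is_path V E Q" "length Q = length P"
      by (auto simp: B_def D_def)
    then show "\<exists>Q. is_path V (insert e E) Q \<and> length Q > length P"
      using closing_edge_extends[OF V ex Q(2)] P(2) by auto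
  qed
  ultimately show ?thesis by blast
qed

subsection \<open>Sprinkling\<close>

definition hamiltonian :: "'a set \<Rightarrow> 'a set set \<Rightarrow> bool" where
  "hamiltonian V E \<longleftrightarrow> (\<exists>P. is_path V E P \<and> set P = V)"

lemma is_path_length_le: "finite V \<Longrightarrow> is_path V E P \<Longrightarrow> length P \<le> card V"
  by (metis card_mono distinct_card is_path_def)

lemma hamiltonian_iff_length:
  assumes "finite V"
  shows "hamiltonian V E \<longleftrightarrow> (\<exists>P. is_path V E P \<and> card V \<le> length P)"
proof
  assume "hamiltonian V E"
  then show "\<exists>P. is_path V E P \<and> card V \<le> length P"
    by (auto simp: hamiltonian_def is_path_def distinct_card)
next
  assume "\<exists>P. is_path V E P \<and> card V \<le> length P"
  then obtain P where P: "is_path V E P" "card V \<le> length P" by blast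
  then have "set P = V"
    using assms by (intro card_seteq) (auto simp: is_path_def distinct_card)
  then show "hamiltonian V E" using P by (auto simp: hamiltonian_def)
qed

lemma hamiltonian_mono: "hamiltonian V E \<Longrightarrow> E \<subseteq> E' \<Longrightarrow> hamiltonian V E'"
  unfolding hamiltonian_def by (blast intro: is_path_mono)

lemma longest_path_exists:
  assumes "finite V" "is_path V E Q"
  obtains P where "longest_path V E P" "length Q \<le> length P"
proof -
  obtain P where "is_path V E P" "\<forall>Q. is_path V E Q \<longrightarrow> length Q \<le> length P"
    using ex_has_greatest_nat[of "is_path V E" Q length "Suc (card V)", OF assms(2)]
      is_path_length_le[OF assms(1)] by (metis less_Suc_eq_le)
  then show thesis using that assms(2) by (auto simp: longest_path_def)
qed

text \<open>Each round hits a booster with probability at least \<open>3/4\<close>. The weights \<open>4 ^ k\<close>, for a path that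
  is \<open>k\<close> vertices short, and \<open>1 / 2 ^ t\<close>, for the \<open>t\<close> remaining rounds, satisfy the resulting
  recursion with equality.\<close>

lemma sprinkling:
  assumes V: "finite V" "8 \<le> card V" and U: "finite U" "pairs V \<subseteq> U"
    and q: "64 / (card V)\<^sup>2 \<le> q" "q \<le> 1"
    and ex: "expander V E" and P0: "is_path V E P0" "card V \<le> length P0 + k"
  shows "measure_pmf.prob (random_subset U (1 - (1 - q) ^ t)) {C. \<not> hamiltonian V (E \<union> C)} \<le> 4 ^ k / 2 ^ t"
  using ex P0
proof (induction t arbitrary: k E P0)
  case 0
  have "1 \<le> (4::real) ^ k / 2 ^ 0" by simp
  then show ?case by (rule order_trans[OF measure_pmf.prob_le_1])
next
  case (Suc t)
  have q0: "0 \<le> q" using q(1) by (rule order_trans[rotated]) simp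
  show ?case
  proof (cases "hamiltonian V E")
    case True
    then have "{C. \<not> hamiltonian V (E \<union> C)} = {}" using hamiltonian_mono[of V E] by blast
    then show ?thesis by simp
  next
    case False
    \<comment> \<open>The new edges of a round may lengthen paths by more than the booster does, so
      the induction keeps only a lower bound through an arbitrary path \<open>P0\<close> and passes
      to a longest one here.\<close>
    obtain P where P: "longest_path V E P" "length P0 \<le> length P"
      using longest_path_exists[OF V(1) Suc.prems(2)] .
    have short: "length P < card V"
      using False P V by (auto simp: longest_path_def hamiltonian_iff_length not_le)
    then obtain k' where k': "k = Suc k'" using Suc.prems(3) P(2) by (cases k) auto
    obtain B where B: "B \<subseteq> pairs V" "(card V)\<^sup>2 \<le> 32 * card B"
      "\<And>e. e \<in> B \<Longrightarrow> \<exists>Q. is_path V (insert e E) Q \<and> length Q > length P"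
      using many_boosters[OF V Suc.prems(1) P(1) short] by blast
    define r where "r = 1 - (1 - q) ^ t"
    have r: "0 \<le> r" "r \<le> 1" using q q0 by (auto simp: r_def power_le_one)
    \<comment> \<open>With \<open>card B\<close> at least 1/32 of the squared number of vertices and
      \<open>q\<close> at least 64 over that square, a round hits two boosters on average; it misses
      all with probability at most \<open>exp (- 2)\<close>, below 1/4.\<close>
    have "2 \<le> q * card B"
    proof -
      have "real ((card V)\<^sup>2) \<le> real (32 * card B)" using B(2) by (rule of_nat_mono)
      then have "64 \<le> 64 / (card V)\<^sup>2 * (32 * card B)"
        using V(2) by (simp add: field_simps)
      also have "\<dots> \<le> q * (32 * card B)" using q(1) by (intro mult_right_mono) auto
      finally show ?thesis by simp
    qed
    then have "exp (2 :: real) \<le> exp (q * card B)" by simp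
    moreover have "exp 1 * exp 1 = exp (2 :: real)" by (simp flip: exp_add)
    moreover have "2 * 2 \<le> exp 1 * exp (1 :: real)" using exp_ge_add_one_self[of 1] by (intro mult_mono) auto
    ultimately have e4: "4 \<le> exp (q * card B)" by linarith
    have "measure_pmf.prob (random_subset U q) {A. B \<inter> A = {}} = (1 - q) ^ card B"
      using prob_cylinder[of U "{}" B q] U B(1) q q0 by auto
    also have "\<dots> \<le> exp (- q) ^ card B"
      using q exp_ge_add_one_self[of "- q"] by (intro power_mono) auto
    also have "\<dots> = 1 / exp (q * card B)"
      by (simp add: exp_minus exp_of_nat_mult[symmetric] field_simps flip: exp_of_nat2_mult)
    also have "\<dots> \<le> 1 / 4" using e4 by (simp add: field_simps)
    finally have hit: "measure_pmf.prob (random_subset U q) {A. B \<inter> A = {}} \<le> 1 / 4" .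
    \<comment> \<open>One round of density \<open>q\<close> comes first, then the remaining
      \<open>t\<close> rounds of total density \<open>r\<close>. A miss leaves the deficit at
      \<open>k\<close>, a hit lowers it to \<open>k'\<close>.\<close>
    have "measure_pmf.prob (random_subset U (1 - (1 - q) * (1 - r))) {C. \<not> hamiltonian V (E \<union> C)}
      \<le> 4 ^ k / 2 ^ t * measure_pmf.prob (random_subset U q) {A. B \<inter> A = {}} + 4 ^ k' / 2 ^ t"
    proof (rule prob_union_le[OF U(1) q0 q(2) r])
      fix A assume A: "A \<subseteq> U"
      have ex: "expander V (E \<union> A)" using expander_mono[OF V(1) Suc.prems(1)] by blast
      have eq: "{C. A \<union> C \<in> {C. \<not> hamiltonian V (E \<union> C)}} = {C. \<not> hamiltonian V ((E \<union> A) \<union> C)}"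
        by (simp add: Un_assoc)
      have "is_path V (E \<union> A) P0" using is_path_mono[OF Suc.prems(2)] by blast
      from Suc.IH[OF ex this Suc.prems(3)]
      show "measure_pmf.prob (random_subset U r) {C. A \<union> C \<in> {C. \<not> hamiltonian V (E \<union> C)}} \<le> 4 ^ k / 2 ^ t"
        unfolding eq r_def .
      assume "A \<notin> {A. B \<inter> A = {}}"
      then obtain e where e: "e \<in> B" "e \<in> A" by blast
      then obtain Q where Q: "is_path V (insert e E) Q" "length Q > length P" using B(3) by blast
      then have "is_path V (E \<union> A) Q" using is_path_mono[OF Q(1), of "E \<union> A"] e by blast
      from Suc.IH[OF ex this, of k']
      show "measure_pmf.prob (random_subset U r) {C. A \<union> C \<in> {C. \<not> hamiltonian V (E \<union> C)}} \<le> 4 ^ k' / 2 ^ t"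
        unfolding eq r_def using Q(2) P(2) Suc.prems(3) k' by linarith
    qed simp_all
    also have "\<dots> \<le> 4 ^ k / 2 ^ t * (1 / 4) + 4 ^ k' / 2 ^ t"
      using hit by (intro add_mono mult_left_mono) auto
    also have "\<dots> = 4 ^ k / 2 ^ Suc t" by (simp add: k' field_simps)
    finally show ?thesis by (simp add: r_def)
  qed
qed

text \<open>The first exposure \<open>p0\<close> supplies expansion. The remaining density 192 / m,
  for m vertices, pays for 3 m sprinkling rounds of density 64 / m^2, by Bernoulli's
  inequality.\<close>

lemma prob_hamiltonian:
  assumes V: "finite V" "8 \<le> card V" and U: "finite U" "pairs V \<subseteq> U"
    and p: "0 \<le> p0" "p0 + 192 / card V \<le> p" "p \<le> 1"
  shows "measure_pmf.prob (random_subset U p) {E. \<not> hamiltonian V E}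
    \<le> measure_pmf.prob (random_subset U p0) {E. \<not> expander V E} + (1 / 2) ^ card V"
proof -
  let ?m = "card V"
  define q where "q = 64 / (real ?m)\<^sup>2"
  define r where "r = 1 - (1 - q) ^ (3 * ?m)"
  have "8\<^sup>2 \<le> (real ?m)\<^sup>2" using V(2) by (intro power_mono) auto
  then have q: "0 \<le> q" "q \<le> 1" by (auto simp: q_def divide_le_eq_1)
  have r: "0 \<le> r" "r \<le> 1" using q by (auto simp: r_def power_le_one)
  have p0: "p0 \<le> 1" using p by (smt (verit) divide_nonneg_nonneg of_nat_0_le_iff)
  have "1 + real (3 * ?m) * (- q) \<le> (1 + - q) ^ (3 * ?m)" using q by (intro Bernoulli_inequality) auto
  then have "r \<le> 3 * ?m * q" by (simp add: r_def)
  also have "\<dots> = 192 / ?m" using V(2) by (simp add: q_def field_simps power2_eq_square)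
  finally have rm: "r \<le> 192 / ?m" .
  have "measure_pmf.prob (random_subset U p) {E. \<not> hamiltonian V E}
      \<le> measure_pmf.prob (random_subset U (1 - (1 - p0) * (1 - r))) {E. \<not> hamiltonian V E}"
  proof (rule prob_upward_closed_mono[OF U(1)])
    show "0 \<le> 1 - (1 - p0) * (1 - r)" using p r p0 mult_le_one[of "1 - p0" "1 - r"] by auto
    have "0 \<le> p0 * r" using p r by simp
    then show "1 - (1 - p0) * (1 - r) \<le> p" using p rm by (simp add: algebra_simps)
  qed (use p hamiltonian_mono[of V] in \<open>auto\<close>)
  also have "\<dots> \<le> 1 * measure_pmf.prob (random_subset U p0) {E. \<not> expander V E} + (1 / 2) ^ card V"
  proof (rule prob_union_le[OF U(1) p(1) p0 r])
    fix A assume "A \<notin> {E. \<not> expander V E}"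
    then have ex: "expander V A" by simp
    obtain v where "v \<in> V" using V(2) by fastforce
    then have "is_path V A [v]" by (simp add: is_path_def)
    \<comment> \<open>A one-vertex path is short by fewer than \<open>?m\<close> vertices; the bound
      \<open>4 ^ ?m / 2 ^ (3 * ?m)\<close> is then \<open>(1 / 2) ^ ?m\<close>.\<close>
    from sprinkling[OF V U _ q(2) ex this, of ?m "3 * ?m"]
    have "measure_pmf.prob (random_subset U r) {C. \<not> hamiltonian V (A \<union> C)} \<le> 4 ^ ?m / 2 ^ (3 * ?m)"
      by (simp add: r_def q_def)
    also have "\<dots> = (4 / 2 ^ 3) ^ ?m" by (simp only: power_mult power_divide)
    finally show "measure_pmf.prob (random_subset U r) {C. A \<union> C \<in> {E. \<not> hamiltonian V E}} \<le> (1 / 2) ^ ?m"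
      by simp
  qed (use measure_pmf.prob_le_1 in auto)
  finally show ?thesis by simp
qed

subsection \<open>Expansion of random graphs\<close>

lemma sum_subsets_by_card:
  fixes f :: "nat \<Rightarrow> real"
  assumes "finite A" "finite K"
  shows "(\<Sum>T | T \<subseteq> A \<and> card T \<in> K. f (card T)) = (\<Sum>k\<in>K. real (card A choose k) * f k)"
proof -
  let ?T = "{T. T \<subseteq> A \<and> card T \<in> K}"
  have fin: "finite ?T" using assms(1) by (auto intro: finite_subset[of _ "Pow A"])
  have "(\<Sum>T\<in>?T. f (card T)) = (\<Sum>k\<in>K. \<Sum>T\<in>{T \<in> ?T. card T = k}. f (card T))"
    by (rule sum.group[symmetric]) (use fin assms in auto)
  also have "\<dots> = (\<Sum>k\<in>K. real (card A choose k) * f k)"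
  proof (rule sum.cong[OF refl])
    fix k assume "k \<in> K"
    then have "{T \<in> ?T. card T = k} = {T. T \<subseteq> A \<and> card T = k}" by auto
    then show "(\<Sum>T\<in>{T \<in> ?T. card T = k}. f (card T)) = real (card A choose k) * f k"
      using n_subsets[OF assms(1), of k] by simp
  qed
  finally show ?thesis .
qed

lemma binomial_le_pow_div_fact: "real (n choose k) \<le> real n ^ k / fact k"
proof -
  have "real ((n choose k) * fact k) \<le> real (n ^ k)" by (rule of_nat_mono) (rule binomial_fact_pow)
  then show ?thesis by (simp add: field_simps)
qed

lemma sum_pow_div_fact_le_exp:
  assumes "0 \<le> (x::real)" "finite K"
  shows "(\<Sum>k\<in>K. x ^ k / fact k) \<le> exp x"
proof -
  have "(\<Sum>k\<in>K. x ^ k / fact k) = (\<Sum>k\<in>K. x ^ k /\<^sub>R fact k)" by (simp add: field_simps)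
  also have "\<dots> \<le> (\<Sum>k. x ^ k /\<^sub>R fact k)"
    using assms summable_exp_generic[of x] by (intro sum_le_suminf) auto
  finally show ?thesis by (simp add: exp_def)
qed

text \<open>Union bound over the maps \<open>\<phi>\<close> that choose for each vertex of
  \<open>T\<close> a neighbour in \<open>S\<close>. Each map prescribes \<open>card T\<close>
  present edges, and all pairs between \<open>S\<close> and the vertices outside \<open>S\<close>
  and \<open>T\<close> must be absent; these two sets of pairs are disjoint, so independence
  applies.\<close>

lemma prob_nbhd_eq:
  fixes p :: real
  assumes V: "finite V" and U: "finite U" "pairs V \<subseteq> U" and p: "0 \<le> p" "p \<le> 1"
    and S: "S \<subseteq> V" "T \<subseteq> V - S"
  shows "measure_pmf.prob (random_subset U p) {E. nbhd V E S = T}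
    \<le> (card S * p) ^ card T * (1 - p) ^ (card S * (card V - card S - card T))"
proof -
  let ?\<Phi> = "PiE T (\<lambda>_. S)"
  let ?N = "V - S - T"
  define A where "A \<phi> = (\<lambda>v. {\<phi> v, v}) ` T" for \<phi> :: "'a \<Rightarrow> 'a"
  define B where "B = (\<lambda>(u, v). {u, v}) ` (S \<times> ?N)"
  have fin: "finite S" "finite T" using V S finite_subset by blast+
  have cN: "card ?N = card V - card S - card T"
    using V S fin by (simp add: card_Diff_subset finite_subset)
  have "inj_on (\<lambda>(u, v). {u, v}) (S \<times> ?N)"
    using S by (auto simp: inj_on_def doubleton_eq_iff)
  then have cB: "card B = card S * card ?N" by (simp add: B_def card_image card_cartesian_product)
  have BU: "B \<subseteq> U" using U(2) S by (auto simp: B_def pairs_def card_insert_if)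
  have "{E. nbhd V E S = T} \<subseteq> (\<Union>\<phi>\<in>?\<Phi>. {E. A \<phi> \<subseteq> E \<and> B \<inter> E = {}})"
  proof
    fix E assume "E \<in> {E. nbhd V E S = T}"
    then have E: "nbhd V E S = T" by simp
    have "\<forall>v\<in>T. \<exists>u\<in>S. {u, v} \<in> E" using E by (auto simp: nbhd_def)
    then obtain \<phi> where \<phi>: "\<forall>v\<in>T. \<phi> v \<in> S \<and> {\<phi> v, v} \<in> E" by metis
    have "B \<inter> E = {}" using E by (auto simp: B_def nbhd_def)
    then show "E \<in> (\<Union>\<phi>\<in>?\<Phi>. {E. A \<phi> \<subseteq> E \<and> B \<inter> E = {}})"
      using \<phi> by (intro UN_I[of "restrict \<phi> T"]) (auto simp: A_def)
  qed
  then have "measure_pmf.prob (random_subset U p) {E. nbhd V E S = T}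
      \<le> measure_pmf.prob (random_subset U p) (\<Union>\<phi>\<in>?\<Phi>. {E. A \<phi> \<subseteq> E \<and> B \<inter> E = {}})"
    by (intro measure_pmf.finite_measure_mono) auto
  also have "\<dots> \<le> (\<Sum>\<phi>\<in>?\<Phi>. measure_pmf.prob (random_subset U p) {E. A \<phi> \<subseteq> E \<and> B \<inter> E = {}})"
    using fin by (intro measure_pmf.finite_measure_subadditive_finite) (auto intro: finite_PiE)
  also have "\<dots> = (\<Sum>\<phi>\<in>?\<Phi>. p ^ card T * (1 - p) ^ card B)"
  proof (rule sum.cong[OF refl])
    fix \<phi> assume \<phi>: "\<phi> \<in> ?\<Phi>"
    then have \<phi>S: "\<phi> v \<in> S" if "v \<in> T" for v using that by auto
    have "inj_on (\<lambda>v. {\<phi> v, v}) T"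
    proof (rule inj_onI)
      fix v w assume "v \<in> T" "w \<in> T" "{\<phi> v, v} = {\<phi> w, w}"
      then show "v = w" using \<phi>S[of v] \<phi>S[of w] S(2) by (auto simp: doubleton_eq_iff)
    qed
    then have "card (A \<phi>) = card T" by (simp add: A_def card_image)
    moreover have "A \<phi> \<subseteq> U"
    proof
      fix e assume "e \<in> A \<phi>"
      then obtain v where "v \<in> T" "e = {\<phi> v, v}" by (auto simp: A_def)
      then have "e \<in> pairs V" using S \<phi>S[of v] by (auto simp: pairs_def card_insert_if)
      then show "e \<in> U" using U(2) by blast
    qed
    moreover have "A \<phi> \<inter> B = {}"
    proof (rule ccontr)
      assume "A \<phi> \<inter> B \<noteq> {}"
      then obtain v u w where "v \<in> T" "u \<in> S" "w \<in> ?N" "{\<phi> v, v} = {u, w}"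
        by (auto simp: A_def B_def)
      then show False using S(2) by (auto simp: doubleton_eq_iff)
    qed
    ultimately show "measure_pmf.prob (random_subset U p) {E. A \<phi> \<subseteq> E \<and> B \<inter> E = {}}
        = p ^ card T * (1 - p) ^ card B"
      using prob_cylinder[OF U(1) _ BU, of "A \<phi>" p] p by simp
  qed
  also have "\<dots> = (card S * p) ^ card T * (1 - p) ^ card B"
    using fin by (simp add: card_PiE power_mult_distrib)
  finally show ?thesis by (simp add: cB cN)
qed

text \<open>Summing over the possible neighbourhoods of size t below 2 s, with m and s the sizes of
  \<open>V\<close> and \<open>S\<close>, gives terms at most
  \<open>(m * p) ^ t * (s ^ t / fact t)\<close>. As \<open>m * p\<close> is at least 1, its exponent
  can be raised to 2 s, and the rest sums to at most \<open>exp s\<close>.\<close>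

lemma prob_small_nbhd:
  fixes p :: real
  assumes V: "finite V" and U: "finite U" "pairs V \<subseteq> U" and p: "0 \<le> p" "p \<le> 1" "1 \<le> card V * p"
    and S: "S \<subseteq> V" "S \<noteq> {}" "4 * card S \<le> card V"
  shows "measure_pmf.prob (random_subset U p) {E. card (nbhd V E S) < 2 * card S}
    \<le> ((card V * p)\<^sup>2 * exp 1 * exp (- p * (real (card V) - 3 * real (card S)))) ^ card S"
proof -
  let ?m = "card V" and ?s = "card S"
  let ?T = "{T. T \<subseteq> V - S \<and> card T \<in> {..<2 * ?s}}"
  let ?c = "exp (- p * (real ?m - 3 * real ?s)) ^ ?s"
  have finT: "finite ?T" using V by (auto intro: finite_subset[of _ "Pow V"])
  have "measure_pmf.prob (random_subset U p) {E. card (nbhd V E S) < 2 * ?s}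
      \<le> measure_pmf.prob (random_subset U p) (\<Union>T\<in>?T. {E. nbhd V E S = T})"
    by (intro measure_pmf.finite_measure_mono) (auto simp: nbhd_def)
  also have "\<dots> \<le> (\<Sum>T\<in>?T. measure_pmf.prob (random_subset U p) {E. nbhd V E S = T})"
    by (intro measure_pmf.finite_measure_subadditive_finite finT) auto
  also have "\<dots> \<le> (\<Sum>T\<in>?T. (?s * p) ^ card T * ?c)"
  proof (rule sum_mono)
    fix T assume T: "T \<in> ?T"
    have "(1 - p) ^ (?s * (?m - ?s - card T)) \<le> exp (- p) ^ (?s * (?m - ?s - card T))"
      using p exp_ge_add_one_self[of "- p"] by (intro power_mono) auto
    also have "\<dots> = (exp (- p) ^ (?m - ?s - card T)) ^ ?s" by (metis mult.commute power_mult)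
    also have "\<dots> = exp (- p * real (?m - ?s - card T)) ^ ?s"
      by (simp add: mult.commute flip: exp_of_nat_mult)
    \<comment> \<open>Fewer than 2 s neighbours leave at least m - 3 s vertices with no edge to
      \<open>S\<close>.\<close>
    also have "\<dots> \<le> ?c"
      using T S(3) p by (intro power_mono) (auto intro!: mult_left_mono simp: of_nat_diff)
    finally have "(1 - p) ^ (?s * (?m - ?s - card T)) \<le> ?c" .
    then have "(?s * p) ^ card T * (1 - p) ^ (?s * (?m - ?s - card T)) \<le> (?s * p) ^ card T * ?c"
      using p by (intro mult_left_mono) auto
    then show "measure_pmf.prob (random_subset U p) {E. nbhd V E S = T} \<le> (?s * p) ^ card T * ?c"
      using prob_nbhd_eq[OF V U p(1,2) S(1), of T] T by simp
  qed
  also have "\<dots> = (\<Sum>t<2 * ?s. real (card (V - S) choose t) * (?s * p) ^ t) * ?c"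
    using V by (subst sum_subsets_by_card[symmetric]) (auto simp: sum_distrib_right)
  also have "\<dots> \<le> ((?m * p) ^ (2 * ?s) * exp ?s) * ?c"
  proof (rule mult_right_mono)
    have "(\<Sum>t<2 * ?s. real (card (V - S) choose t) * (?s * p) ^ t)
        \<le> (\<Sum>t<2 * ?s. (?m * p) ^ (2 * ?s) * (real ?s ^ t / fact t))"
    proof (rule sum_mono)
      fix t assume t: "t \<in> {..<2 * ?s}"
      have "real (card (V - S) choose t) \<le> real (card (V - S)) ^ t / fact t"
        by (rule binomial_le_pow_div_fact)
      also have "\<dots> \<le> real ?m ^ t / fact t"
        using V by (intro divide_right_mono power_mono) (auto intro: card_mono)
      finally have "real (card (V - S) choose t) * (?s * p) ^ t \<le> real ?m ^ t / fact t * (?s * p) ^ t"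
        using p by (intro mult_right_mono) auto
      also have "\<dots> = (?m * p) ^ t * (real ?s ^ t / fact t)" by (simp add: power_mult_distrib)
      also have "\<dots> \<le> (?m * p) ^ (2 * ?s) * (real ?s ^ t / fact t)"
        using p t by (intro mult_right_mono power_increasing) auto
      finally show "real (card (V - S) choose t) * (?s * p) ^ t \<le> (?m * p) ^ (2 * ?s) * (real ?s ^ t / fact t)" .
    qed
    also have "\<dots> \<le> (?m * p) ^ (2 * ?s) * exp ?s"
      unfolding sum_distrib_left[symmetric] using p by (intro mult_left_mono sum_pow_div_fact_le_exp) auto
    finally show "(\<Sum>t<2 * ?s. real (card (V - S) choose t) * (?s * p) ^ t) \<le> (?m * p) ^ (2 * ?s) * exp ?s" .
  qed simp
  also have "\<dots> = ((?m * p)\<^sup>2 * exp 1 * exp (- p * (real ?m - 3 * real ?s))) ^ ?s"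
    by (simp add: power_mult_distrib power_mult flip: exp_of_nat_mult)
  finally show ?thesis .
qed

lemma prob_not_expander:
  fixes p :: real
  assumes V: "finite V" and U: "finite U" "pairs V \<subseteq> U" and p: "0 \<le> p" "p \<le> 1" "1 \<le> card V * p"
  shows "measure_pmf.prob (random_subset U p) {E. \<not> expander V E}
    \<le> (\<Sum>s = 1..card V div 4.
        (exp 2 * (card V * p)\<^sup>2 * (card V / s) * exp (- p * (real (card V) - 3 * real s))) ^ s)"
proof -
  let ?m = "card V"
  let ?S = "{S. S \<subseteq> V \<and> card S \<in> {1..?m div 4}}"
  define g where "g s = ((?m * p)\<^sup>2 * exp 1 * exp (- p * (real ?m - 3 * real s))) ^ s" for s
  have finS: "finite ?S" using V by (auto intro: finite_subset[of _ "Pow V"])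
  have S: "S \<subseteq> V" "S \<noteq> {}" "4 * card S \<le> ?m" if "S \<in> ?S" for S using that by auto
  have "{E. \<not> expander V E} \<subseteq> (\<Union>S\<in>?S. {E. card (nbhd V E S) < 2 * card S})"
  proof
    fix E assume "E \<in> {E. \<not> expander V E}"
    then obtain S where S: "S \<subseteq> V" "S \<noteq> {}" "4 * card S \<le> ?m" "card (nbhd V E S) < 2 * card S"
      by (auto simp: expander_def not_le)
    have "card S > 0" using S V by (simp add: card_gt_0_iff finite_subset)
    then show "E \<in> (\<Union>S\<in>?S. {E. card (nbhd V E S) < 2 * card S})" using S by auto
  qed
  then have "measure_pmf.prob (random_subset U p) {E. \<not> expander V E}
      \<le> measure_pmf.prob (random_subset U p) (\<Union>S\<in>?S. {E. card (nbhd V E S) < 2 * card S})"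
    by (intro measure_pmf.finite_measure_mono) auto
  also have "\<dots> \<le> (\<Sum>S\<in>?S. measure_pmf.prob (random_subset U p) {E. card (nbhd V E S) < 2 * card S})"
    by (intro measure_pmf.finite_measure_subadditive_finite finS) auto
  also have "\<dots> \<le> (\<Sum>S\<in>?S. g (card S))"
    unfolding g_def by (intro sum_mono prob_small_nbhd[OF V U p] S)
  also have "\<dots> = (\<Sum>s = 1..?m div 4. real (?m choose s) * g s)"
    by (rule sum_subsets_by_card) (use V in auto)
  also have "\<dots> \<le> (\<Sum>s = 1..?m div 4.
        (exp 2 * (?m * p)\<^sup>2 * (?m / s) * exp (- p * (real ?m - 3 * real s))) ^ s)"
  proof (rule sum_mono)
    fix s assume s: "s \<in> {1..?m div 4}"
    \<comment> \<open>A single term of the exponential series bounds \<open>fact s\<close> from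
      below by (s / e)^s, so the number of sets of size s is at most (e m / s)^s.\<close>
    have "real s ^ s / fact s \<le> exp s" using sum_pow_div_fact_le_exp[of s "{s}"] by simp
    then have "1 / fact s \<le> exp s / real s ^ s" using s by (simp add: field_simps)
    then have "real ?m ^ s * (1 / fact s) \<le> real ?m ^ s * (exp s / real s ^ s)" by (intro mult_left_mono) auto
    then have "real (?m choose s) \<le> real ?m ^ s * (exp s / real s ^ s)"
      using binomial_le_pow_div_fact[of ?m s] by simp
    also have "\<dots> = (exp 1 * (?m / s)) ^ s"
      by (simp add: power_mult_distrib power_divide flip: exp_of_nat_mult)
    finally have "real (?m choose s) * g s \<le> (exp 1 * (?m / s)) ^ s * g s"
      by (intro mult_right_mono) (auto simp: g_def)
    also have "\<dots> = (exp 2 * (?m * p)\<^sup>2 * (?m / s) * exp (- p * (real ?m - 3 * real s))) ^ s"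
    proof -
      have "exp 2 = exp 1 * exp (1 :: real)" by (simp flip: exp_add)
      then show ?thesis by (simp add: g_def mult_ac flip: power_mult_distrib)
    qed
    finally show "real (?m choose s) * g s
      \<le> (exp 2 * (?m * p)\<^sup>2 * (?m / s) * exp (- p * (real ?m - 3 * real s))) ^ s" .
  qed
  finally show ?thesis .
qed

subsection \<open>The Hamiltonicity threshold\<close>

lemma sum_geometric_le:
  assumes "0 \<le> b" "b \<le> (1 / 2 :: real)"
  shows "(\<Sum>s = 1..N. b ^ s) \<le> 2 * b"
proof -
  have "(\<Sum>s = 1..N. b ^ s) \<le> 2 * b * (1 - (1 / 2) ^ N)"
  proof (induction N)
    case (Suc N)
    have "b * b ^ N \<le> b * (1 / 2) ^ N" using assms by (intro mult_left_mono power_mono) auto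
    then show ?case using Suc by (simp add: algebra_simps)
  qed simp
  also have "\<dots> \<le> 2 * b * 1" using assms by (intro mult_left_mono) auto
  finally show ?thesis by simp
qed

text \<open>The first exposure has \<open>m * p0 = L m\<close>, so a vertex avoids all others with
  probability about 1 / (m (ln m)^4). The factor \<open>(m * p0)\<^sup>2\<close> costs about (ln
  m)^2, and the error left is of order 1 / (ln m)^2, small enough for a union over logarithmically
  many vertex sets. The constant 192 pays for sprinkling. Uniformity in \<open>V\<close>,
  \<open>U\<close> and \<open>p\<close> permits that union inside a single random graph.\<close>

lemma prob_not_hamiltonian:
  "\<forall>\<^sub>F m in sequentially. \<forall>(V :: 'a set) U p. finite U \<longrightarrow> card V = m \<longrightarrow> pairs V \<subseteq> U \<longrightarrow>
    (ln m + 4 * ln (ln m) + 192) / m \<le> p \<longrightarrow> p \<le> 1 \<longrightarrow>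
    measure_pmf.prob (random_subset U p) {E. \<not> hamiltonian V E} \<le> (8 * exp 5 + 1) / (ln m)\<^sup>2"
proof -
  define L where "L x = ln x + 4 * ln (ln x)" for x :: real
  have "\<forall>\<^sub>F x in at_top. 8 \<le> x \<and> 0 < ln x \<and> L x \<le> 2 * ln x \<and> 1 \<le> L x \<and>
      exp (3 * L x / 4) * L x / x \<le> 1 \<and> 4 * exp 5 / (ln x)\<^sup>2 \<le> 1 / 2 \<and> (1 / 2) powr x \<le> 1 / (ln x)\<^sup>2"
    unfolding L_def by (intro eventually_conj; real_asymp)
  then have "\<forall>\<^sub>F m in sequentially. 8 \<le> real m \<and> 0 < ln (real m) \<and> L m \<le> 2 * ln m \<and> 1 \<le> L m \<and>
      exp (3 * L m / 4) * L m / m \<le> 1 \<and> 4 * exp 5 / (ln m)\<^sup>2 \<le> 1 / 2 \<and> (1 / 2) powr m \<le> 1 / (ln m)\<^sup>2"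
    by (rule eventually_compose_filterlim) (rule filterlim_real_sequentially)
  then show ?thesis
  proof (rule eventually_mono, intro allI impI)
    fix m :: nat and V :: "'a set" and U p
    assume A: "8 \<le> real m \<and> 0 < ln (real m) \<and> L m \<le> 2 * ln m \<and> 1 \<le> L m \<and>
      exp (3 * L m / 4) * L m / m \<le> 1 \<and> 4 * exp 5 / (ln m)\<^sup>2 \<le> 1 / 2 \<and> (1 / 2) powr m \<le> 1 / (ln m)\<^sup>2"
      and U: "finite U" and m: "card V = m" and VU: "pairs V \<subseteq> U"
      and p: "(ln m + 4 * ln (ln m) + 192) / m \<le> p" "p \<le> 1"
    define b where "b = 4 * exp 5 / (ln (real m))\<^sup>2"
    define p0 where "p0 = L m / m"
    have m8: "8 \<le> m" using A by linarith
    have V: "finite V" using m m8 by (intro card_ge_0_finite) auto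
    have p0: "0 \<le> p0" "p0 + 192 / m \<le> p" "m * p0 = L m"
    proof -
      show "0 \<le> p0" using A by (simp add: p0_def)
      show "p0 + 192 / m \<le> p" using p(1) by (simp add: p0_def L_def add_divide_distrib)
      show "m * p0 = L m" using m8 by (simp add: p0_def)
    qed
    then have "p0 \<le> 1" using p(2) by (smt (verit) divide_nonneg_nonneg of_nat_0_le_iff)
    have eL: "exp (- L m) = 1 / (m * ln m ^ 4)"
    proof -
      have "exp (L m) = exp (ln m) * exp (ln (ln m)) ^ 4"
        by (simp add: L_def exp_add exp_of_nat_mult[of 4, simplified])
      then show ?thesis using A m8 by (simp add: exp_minus field_simps)
    qed
    have base: "exp 2 * (m * p0)\<^sup>2 * (m / s) * exp (- p0 * (real m - 3 * real s)) \<le> b"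
      if s: "s \<in> {1..m div 4}" for s
    proof -
      have s1: "1 \<le> real s" "4 * real s \<le> real m" using s by auto
      \<comment> \<open>For small s the exponent is at most 3. For s above m / L the bound s \<le> m
        / 4 gives \<open>exp (3 * L m / 4)\<close>, which is at most m / L and hence below
        s.\<close>
      have "exp (3 * s * L m / m) \<le> exp 3 * s"
      proof (cases "s * L m \<le> m")
        case True
        then have "3 * s * L m / m \<le> 3" using m8 by (simp add: field_simps)
        then have "exp (3 * s * L m / m) \<le> exp 3 * 1" by simp
        also have "\<dots> \<le> exp 3 * s" using s1 by (intro mult_left_mono) auto
        finally show ?thesis .
      next
        case False
        have "4 * real s * L m \<le> real m * L m" using s1 A by (intro mult_right_mono) auto
        then have "3 * s * L m / m \<le> 3 * L m / 4" using m8 by (simp add: field_simps)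
        then have "exp (3 * s * L m / m) \<le> exp (3 * L m / 4)" by simp
        also have "\<dots> \<le> m / L m" using A m8 by (simp add: field_simps)
        also have "\<dots> \<le> 1 * real s" using False A by (simp add: field_simps)
        also have "\<dots> \<le> exp 3 * s" by (intro mult_right_mono) auto
        finally show ?thesis .
      qed
      then have e3: "exp (3 * s * L m / m) / s \<le> exp 3" using s1 by (simp add: field_simps)
      have "- p0 * (real m - 3 * real s) = - L m + 3 * s * L m / m"
        using m8 by (simp add: p0_def field_simps)
      then have "exp (- p0 * (real m - 3 * real s)) = 1 / (m * ln m ^ 4) * exp (3 * s * L m / m)"
        by (simp only: exp_add eL)
      then have "exp 2 * (m * p0)\<^sup>2 * (m / s) * exp (- p0 * (real m - 3 * real s))
          = exp 2 * ((L m)\<^sup>2 / ln m ^ 4) * (exp (3 * s * L m / m) / s)"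
        using m8 s1 A by (simp add: p0(3)) (simp add: mult_ac)
      also have "\<dots> \<le> exp 2 * ((2 * ln m)\<^sup>2 / ln m ^ 4) * exp 3"
        using A e3 by (intro mult_mono mult_left_mono divide_right_mono power_mono) auto
      also have "\<dots> = 4 * (exp 2 * exp 3) / (ln m)\<^sup>2"
        using A by (simp add: power2_eq_square power4_eq_xxxx)
      also have "\<dots> = b" by (simp add: b_def flip: exp_add)
      finally show ?thesis .
    qed
    have "measure_pmf.prob (random_subset U p) {E. \<not> hamiltonian V E}
      \<le> measure_pmf.prob (random_subset U p0) {E. \<not> expander V E} + (1 / 2) ^ card V"
      using p0 by (intro prob_hamiltonian V U VU p(2)) (use m m8 in auto)
    also have "measure_pmf.prob (random_subset U p0) {E. \<not> expander V E}
      \<le> (\<Sum>s = 1..m div 4. (exp 2 * (m * p0)\<^sup>2 * (m / s) * exp (- p0 * (real m - 3 * real s))) ^ s)"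
      using prob_not_expander[OF V U VU p0(1) \<open>p0 \<le> 1\<close>] A p0(3) by (simp add: m)
    also have "\<dots> \<le> (\<Sum>s = 1..m div 4. b ^ s)" by (intro sum_mono power_mono base) auto
    also have "\<dots> \<le> 2 * b" using A by (intro sum_geometric_le) (auto simp: b_def)
    also have "(1 / 2) ^ card V \<le> 1 / (ln m)\<^sup>2" using A by (simp add: m powr_realpow)
    also have "2 * b + 1 / (ln m)\<^sup>2 = (8 * exp 5 + 1) / (ln m)\<^sup>2" by (simp add: b_def add_divide_distrib)
    finally show "measure_pmf.prob (random_subset U p) {E. \<not> hamiltonian V E} \<le> (8 * exp 5 + 1) / (ln m)\<^sup>2"
      by simp
  qed
qed

subsection \<open>Isolated vertices\<close>

definition isolated :: "'a set \<Rightarrow> 'a set set \<Rightarrow> 'a set" where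
  "isolated V E = {v \<in> V. \<forall>u\<in>V - {v}. {u, v} \<notin> E}"

lemma path_through_isolated:
  assumes P: "is_path V E P" and v: "v \<in> set P" "v \<in> isolated V E"
  shows "P = [v]"
proof -
  obtain xs ys where Ps: "P = xs @ v # ys" using v(1) by (meson split_list)
  have "ys = []"
  proof (rule ccontr)
    assume ys: "ys \<noteq> []"
    then have "{v, hd ys} \<in> E" using path_edges_snoc_append[OF ys] P Ps by (auto simp: is_path_iff_path_edges)
    moreover have "hd ys \<in> V - {v}" using P Ps ys by (auto simp: is_path_def)
    ultimately show False using v(2) by (auto simp: isolated_def insert_commute)
  qed
  moreover have "xs = []"
  proof (rule ccontr)
    assume xs: "xs \<noteq> []"
    then have "{last xs, v} \<in> E" using path_edges_append[OF xs, of "v # ys"] P Ps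
      by (auto simp: is_path_iff_path_edges)
    moreover have "last xs \<in> V - {v}" using P Ps xs by (auto simp: is_path_def)
    ultimately show False using v(2) by (auto simp: isolated_def)
  qed
  ultimately show ?thesis using Ps by simp
qed

text \<open>In a minimum separating family, the isolated vertices that are covered have distinct
  one-vertex paths, and at most one vertex can be left uncovered, since uncovered vertices are not
  separated from each other.\<close>

lemma card_isolated_le_sp:
  assumes V: "finite V"
  shows "card (isolated V E) \<le> sp V E + 1"
proof -
  let ?I = "isolated V E"
  have "\<exists>k F. path_family V E F \<and> separates F V \<and> card F = k"
    using ex_separating_covering_family[OF V] by blast
  then have "\<exists>F. path_family V E F \<and> separates F V \<and> card F = sp V E"
    unfolding sp_def by (rule LeastI_ex)
  then obtain F where F: "path_family V E F" "separates F V" "card F = sp V E" by blast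
  have IV: "?I \<subseteq> V" by (auto simp: isolated_def)
  have finI: "finite ?I" using IV V finite_subset by blast
  define A where "A = {v \<in> ?I. containing F v \<noteq> {}}"
  have "(\<lambda>v. [v]) ` A \<subseteq> F"
  proof
    fix P assume "P \<in> (\<lambda>v. [v]) ` A"
    then obtain v Q where v: "P = [v]" "v \<in> ?I" "Q \<in> F" "v \<in> set Q"
      by (auto simp: A_def containing_def)
    then have "Q = [v]" using F(1) by (intro path_through_isolated) (auto simp: path_family_def)
    then show "P \<in> F" using v by simp
  qed
  then have "card ((\<lambda>v. [v]) ` A) \<le> card F" using F(1) by (intro card_mono) (auto simp: path_family_def)
  then have cA: "card A \<le> sp V E" using F(3) by (simp add: card_image inj_on_def)
  have "u = v" if "u \<in> ?I - A" "v \<in> ?I - A" for u v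
  proof -
    have "containing F u = containing F v" using that by (simp add: A_def)
    then show ?thesis using that F(2) IV unfolding separates_def by blast
  qed
  then have "card (?I - A) \<le> 1" using finI by (simp add: card_le_Suc0_iff_eq)
  moreover have "card ?I = card A + card (?I - A)"
    using finI card_Diff_subset[of A ?I] card_mono[of ?I A] finite_subset[of A ?I] by (auto simp: A_def)
  ultimately show ?thesis using cA by linarith
qed

section \<open>Second moment of the number of isolated vertices\<close>

definition star :: "'a set \<Rightarrow> 'a \<Rightarrow> 'a set set" where
  "star V v = (\<lambda>u. {u, v}) ` (V - {v})"

lemma isolated_iff_star: "v \<in> isolated V E \<longleftrightarrow> v \<in> V \<and> star V v \<inter> E = {}"
  by (auto simp: isolated_def star_def)

lemma card_star: "finite V \<Longrightarrow> v \<in> V \<Longrightarrow> card (star V v) = card V - 1"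
  unfolding star_def by (subst card_image) (auto simp: inj_on_def doubleton_eq_iff)

lemma card_star_Un:
  assumes "finite V" "u \<in> V" "v \<in> V" "u \<noteq> v"
  shows "card (star V u \<union> star V v) = 2 * card V - 3"
proof -
  have "star V u \<inter> star V v = {{u, v}}"
    using assms by (auto simp: star_def doubleton_eq_iff image_iff)
  moreover have "card (star V u \<union> star V v) + card (star V u \<inter> star V v) = card (star V u) + card (star V v)"
    using assms by (intro card_Un_Int[symmetric]) (auto simp: star_def)
  moreover have "card {u, v} \<le> card V" using assms by (intro card_mono) auto
  ultimately show ?thesis using card_star[OF assms(1,2)] card_star[OF assms(1,3)] assms(4) by simp
qed

lemma star_subset_pairs: "v \<in> V \<Longrightarrow> star V v \<subseteq> pairs V"
  by (auto simp: star_def pairs_def card_insert_if)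

text \<open>Chebyshev's inequality. The expected number of isolated vertices is
  \<open>\<mu>\<close>. Two stars share exactly one pair, so two vertices are both isolated with
  probability \<open>s\<^sup>2 / (1 - p)\<close>, and the variance is at most
  \<open>\<mu> + \<mu>\<^sup>2 * p / (1 - p)\<close>.\<close>

lemma prob_few_isolated:
  fixes V :: "'a set" and p :: real
  assumes V: "finite V" "V \<noteq> {}" and p: "0 \<le> p" "p < 1"
  defines "\<mu> \<equiv> card V * (1 - p) ^ (card V - 1)"
  shows "measure_pmf.prob (random_subset (pairs V) p) {E. card (isolated V E) \<le> \<mu> / 2}
    \<le> 4 / \<mu> + 4 * p / (1 - p)"
proof -
  let ?n = "card V" and ?U = "pairs V"
  let ?M = "random_subset ?U p"
  define X where "X E = real (card (isolated V E))" for E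
  define Z where "Z v = {E. v \<in> isolated V E}" for v
  define s where "s = (1 - p) ^ (?n - 1)"
  have n: "?n \<ge> 1" using V by (simp add: Suc_leI card_gt_0_iff)
  have s: "s > 0" "\<mu> = ?n * s" using p by (auto simp: s_def \<mu>_def)
  have \<mu>: "\<mu> > 0" using s n by simp
  have finU: "finite ?U" using V(1) by (auto simp: pairs_def intro: finite_subset[of _ "Pow V"])
  have "finite (set_pmf ?M)"
    using set_random_subset[OF finU] finU by (meson finite_Pow_iff finite_subset)
  then have int: "integrable (measure_pmf ?M) f" for f :: "_ \<Rightarrow> real"
    by (rule integrable_measure_pmf_finite)
  have X: "X E = (\<Sum>v\<in>V. indicator (Z v) E)" for E
  proof -
    have "(\<Sum>v\<in>V. indicator (Z v) E) = (\<Sum>v\<in>V. if v \<in> isolated V E then 1 else (0::real))"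
      by (intro sum.cong) (auto simp: Z_def indicator_def)
    also have "\<dots> = card (V \<inter> isolated V E)" using V(1) by (simp flip: sum.inter_restrict)
    also have "V \<inter> isolated V E = isolated V E" by (auto simp: isolated_def)
    finally show ?thesis by (simp add: X_def)
  qed
  have one: "measure_pmf.prob ?M (Z v) = s" if "v \<in> V" for v
    using prob_cylinder[OF finU _ star_subset_pairs[OF that], of "{}" p] p that V
    by (simp add: Z_def isolated_iff_star card_star s_def)
  have two: "measure_pmf.prob ?M (Z u \<inter> Z v) = s\<^sup>2 / (1 - p)" if "u \<in> V" "v \<in> V" "u \<noteq> v" for u v
  proof -
    have "card {u, v} \<le> card V" using that V by (intro card_mono) auto
    then have n2: "2 \<le> card V" using that by simp
    have "Z u \<inter> Z v = {E. {} \<subseteq> E \<and> (star V u \<union> star V v) \<inter> E = {}}"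
      using that by (auto simp: Z_def isolated_iff_star)
    then have "measure_pmf.prob ?M (Z u \<inter> Z v) = (1 - p) ^ (2 * ?n - 3)"
      using prob_cylinder[OF finU, of "{}" "star V u \<union> star V v" p] p that V
        star_subset_pairs[OF that(1)] star_subset_pairs[OF that(2)] by (simp add: card_star_Un)
    moreover have "(1 - p) ^ (2 * ?n - 3) * (1 - p) = s\<^sup>2"
    proof -
      have "Suc (2 * ?n - 3) = 2 * (?n - 1)" using n2 by simp
      then have "(1 - p) ^ Suc (2 * ?n - 3) = s\<^sup>2"
        by (simp only: s_def power_mult[symmetric] mult.commute)
      then show ?thesis by (simp add: mult.commute)
    qed
    ultimately show ?thesis using p by (simp add: field_simps)
  qed
  have EX: "measure_pmf.expectation ?M X = \<mu>"
    unfolding X using int by (simp add: Bochner_Integration.integral_sum one s)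
  have "measure_pmf.expectation ?M (\<lambda>E. (X E)\<^sup>2)
      = measure_pmf.expectation ?M (\<lambda>E. \<Sum>u\<in>V. \<Sum>v\<in>V. indicator (Z u \<inter> Z v) E)"
    unfolding X by (simp add: power2_eq_square sum_product indicator_inter_arith)
  also have "\<dots> = (\<Sum>u\<in>V. \<Sum>v\<in>V. measure_pmf.prob ?M (Z u \<inter> Z v))"
    using int by (simp add: Bochner_Integration.integral_sum)
  \<comment> \<open>The diagonal terms equal \<open>s\<close>; granting them the off-diagonal bound
    as well keeps the double sum in closed form.\<close>
  also have "\<dots> \<le> (\<Sum>u\<in>V. \<Sum>v\<in>V. (if v = u then s else 0) + s\<^sup>2 / (1 - p))"
  proof (intro sum_mono)
    fix u v assume "u \<in> V" "v \<in> V"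
    then show "measure_pmf.prob ?M (Z u \<inter> Z v) \<le> (if v = u then s else 0) + s\<^sup>2 / (1 - p)"
      using one[of u] two[of u v] p by auto
  qed
  also have "\<dots> = \<mu> + \<mu>\<^sup>2 / (1 - p)"
    using V by (simp add: sum.distrib s(2) power2_eq_square algebra_simps)
  finally have E2: "measure_pmf.expectation ?M (\<lambda>E. (X E)\<^sup>2) \<le> \<mu> + \<mu>\<^sup>2 / (1 - p)" .
  have var: "measure_pmf.variance ?M X
      = measure_pmf.expectation ?M (\<lambda>E. (X E)\<^sup>2) - (measure_pmf.expectation ?M X)\<^sup>2"
    by (intro measure_pmf.variance_eq int)
  have "measure_pmf.prob ?M {E. card (isolated V E) \<le> \<mu> / 2}
      \<le> measure_pmf.prob ?M {E \<in> space (measure_pmf ?M). \<mu> / 2 \<le> \<bar>X E - measure_pmf.expectation ?M X\<bar>}"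
    by (intro measure_pmf.finite_measure_mono) (auto simp: EX X_def)
  also have "\<dots> \<le> measure_pmf.variance ?M X / (\<mu> / 2)\<^sup>2"
    using int \<mu> by (intro measure_pmf.Chebyshev_inequality) auto
  also have "\<dots> \<le> (\<mu> + \<mu>\<^sup>2 / (1 - p) - \<mu>\<^sup>2) / (\<mu> / 2)\<^sup>2"
    unfolding var unfolding EX using E2 by (intro divide_right_mono) auto
  also have "\<dots> = 4 / \<mu> + 4 * p / (1 - p)"
    using \<mu> p by (simp add: field_simps power2_eq_square)
  finally show ?thesis .
qed

subsection \<open>Separating path systems\<close>

text \<open>The vertices \<open>2 j\<close> and \<open>2 j + 1\<close> carry complementary code words, so that every bit
  splits the vertices into halves.\<close>

definition code_set :: "nat \<Rightarrow> nat \<Rightarrow> nat set" where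
  "code_set n i = {v. v < n \<and> bit (v div 2) i \<noteq> odd v}"

lemma card_code_set_double: "card (code_set (2 * j) i) = j"
proof (induction j)
  case (Suc j)
  define w where "w = (if bit j i then 2 * j else 2 * j + 1)"
  have "code_set (2 * Suc j) i = insert w (code_set (2 * j) i)"
  proof (intro set_eqI)
    fix v
    have "v < 2 * Suc j \<longleftrightarrow> v < 2 * j \<or> v = 2 * j \<or> v = 2 * j + 1" by auto
    then show "v \<in> code_set (2 * Suc j) i \<longleftrightarrow> v \<in> insert w (code_set (2 * j) i)"
      by (auto simp: code_set_def w_def)
  qed
  moreover have "w \<notin> code_set (2 * j) i" by (auto simp: code_set_def w_def)
  moreover have "finite (code_set (2 * j) i)" by (simp add: code_set_def)
  ultimately show ?case using Suc by simp
qed (simp add: code_set_def)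

text \<open>Each pair of vertices 2 j, 2 j + 1 contributes exactly one vertex; for odd n the last
  vertex has no partner, hence the additive 1.\<close>

lemma card_code_set: "n \<le> 2 * card (code_set n i) + 1" "card (code_set n i) \<le> n"
proof -
  have fin: "finite (code_set n i)" by (simp add: code_set_def)
  have "code_set (2 * (n div 2)) i \<subseteq> code_set n i" by (auto simp: code_set_def)
  then have "n div 2 \<le> card (code_set n i)" using card_mono[OF fin] by (metis card_code_set_double)
  then show "n \<le> 2 * card (code_set n i) + 1" by linarith
  have "code_set n i \<subseteq> {..<n}" by (auto simp: code_set_def)
  then show "card (code_set n i) \<le> n" using card_mono[of "{..<n}"] by fastforce
qed

text \<open>The number \<open>v div 2\<close> is below \<open>2 ^ (k - 1)\<close>, so its bit
  \<open>k - 1\<close> vanishes and that code set consists of the odd numbers. It reveals the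
  parity, after which the other code sets reveal the bits of \<open>v div 2\<close>.\<close>

lemma code_sets_separate:
  assumes n: "n \<le> 2 ^ k" and uv: "u < n" "v < n" "u \<noteq> v"
  shows "\<exists>i<k. u \<in> code_set n i \<longleftrightarrow> v \<notin> code_set n i"
proof (rule ccontr)
  assume "\<not> ?thesis"
  then have eq: "(bit (u div 2) i \<noteq> odd u) = (bit (v div 2) i \<noteq> odd v)" if "i < k" for i
    using that uv by (auto simp: code_set_def)
  obtain k' where k: "k = Suc k'" using n uv by (cases k) auto
  have high: "\<not> bit (w div 2) i" if "w < n" "k' \<le> i" for w i
  proof -
    have "w div 2 < 2 ^ k'" using that n k by auto
    also have "\<dots> \<le> (2::nat) ^ i" using that by (intro power_increasing) auto
    finally show ?thesis by (simp add: bit_iff_odd)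
  qed
  have par: "odd u = odd v" using eq[of k'] high[of u k'] high[of v k'] uv k by auto
  have "u div 2 = v div 2"
  proof (rule bit_eqI)
    fix i show "bit (u div 2) i = bit (v div 2) i"
      using eq[of i] par high[of u i] high[of v i] uv k by (cases "i < k") auto
  qed
  moreover have "u mod 2 = v mod 2" using par by presburger
  ultimately show False using uv(3) by (metis div_mult_mod_eq)
qed

text \<open>The paths through the code sets separate. Vertex 0 lies in no code set, and the path
  through all vertices covers it.\<close>

lemma sp_star_le:
  assumes n: "n \<le> 2 ^ k"
    and ham: "\<And>i. i < k \<Longrightarrow> hamiltonian (code_set n i) E" "hamiltonian (vertices n) E"
  shows "sp_star (vertices n) E \<le> k + 1"
proof -
  obtain P where P: "\<And>i. i < k \<Longrightarrow> is_path (code_set n i) E (P i) \<and> set (P i) = code_set n i"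
    using ham(1) unfolding hamiltonian_def by metis
  obtain P0 where P0: "is_path (vertices n) E P0" "set P0 = vertices n"
    using ham(2) unfolding hamiltonian_def by blast
  define F where "F = insert P0 (P ` {..<k})"
  have "code_set n i \<subseteq> vertices n" for i by (auto simp: code_set_def vertices_def)
  then have "path_family (vertices n) E F"
    using P P0 unfolding path_family_def F_def is_path_def by (auto 4 4)
  moreover have "separates F (vertices n)"
    unfolding separates_def
  proof (intro ballI impI)
    fix u v assume "u \<in> vertices n" "v \<in> vertices n" "u \<noteq> v"
    then obtain i where i: "i < k" "u \<in> code_set n i \<longleftrightarrow> v \<notin> code_set n i"
      using code_sets_separate[OF n, of u v] by (auto simp: vertices_def)
    then have "P i \<in> containing F u \<longleftrightarrow> P i \<notin> containing F v"
      using P[of i] by (auto simp: containing_def F_def)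
    then show "containing F u \<noteq> containing F v" by blast
  qed
  moreover have "covers F (vertices n)"
    using P0 by (auto simp: covers_def containing_def F_def)
  ultimately have "sp_star (vertices n) E \<le> card F"
    unfolding sp_star_def by (intro Least_le) blast
  also have "\<dots> \<le> k + 1"
    unfolding F_def using card_insert_le_m1 card_image_le[of "{..<k}" P] by (simp add: card_insert_if)
  finally show ?thesis .
qed

section \<open>The two density regimes\<close>

lemma whpI:
  assumes "\<forall>\<^sub>F n in sequentially. measure_pmf.prob (M n) {x. \<not> Q n x} \<le> e n" "e \<longlonglongrightarrow> 0"
  shows "whp M Q"
proof -
  have "(\<lambda>n. measure_pmf.prob (M n) {x. \<not> Q n x}) \<longlonglongrightarrow> 0"
    by (rule tendsto_sandwich[OF _ assms(1) tendsto_const assms(2)]) simp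
  then have "(\<lambda>n. 1 - measure_pmf.prob (M n) {x. \<not> Q n x}) \<longlonglongrightarrow> 1 - 0"
    by (intro tendsto_intros)
  moreover have "1 - measure_pmf.prob (M n) {x. \<not> Q n x} = measure_pmf.prob (M n) {x. Q n x}" for n
    using measure_pmf.prob_compl[of "{x. Q n x}" "M n"] by (simp add: Compl_eq_Diff_UNIV[symmetric] Collect_neg_eq[symmetric])
  ultimately show ?thesis by (simp add: whp_def)
qed

lemma dominates_lnln_ge:
  assumes "dominates f (\<lambda>n. ln (ln (real n)))"
  shows "\<forall>\<^sub>F n in sequentially. f n \<ge> c * ln (ln (real n))"
proof -
  have "\<forall>\<^sub>F n in sequentially. c \<le> f n / ln (ln (real n))"
    using assms unfolding dominates_def filterlim_at_top by blast
  moreover have "\<forall>\<^sub>F n in sequentially. 0 < ln (ln (real n))" by real_asymp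
  ultimately show ?thesis by eventually_elim (simp add: field_simps)
qed

lemma all_pairs_eq: "all_pairs n = pairs (vertices n)"
  by (simp add: all_pairs_def pairs_def)

lemma finite_all_pairs: "finite (all_pairs n)"
  by (auto simp: all_pairs_def vertices_def intro: finite_subset[of _ "Pow {..<n}"])

text \<open>Union bound over the vertex set and its \<open>k\<close> halves: k + 1 is of order ln n,
  while each set fails to be Hamiltonian with probability of order 1 / (ln n)^2.\<close>

lemma upper_bound:
  assumes p_prob: "\<And>n. 0 \<le> p n \<and> p n \<le> 1"
    and f: "dominates f (\<lambda>n. ln (ln (real n)))"
    and p: "\<forall>\<^sub>F n in sequentially. p n \<ge> (2 * ln (real n) + f n) / real n"
  shows "whp (\<lambda>n. gnp n (p n)) (\<lambda>n E. int (sp_star (vertices n) E) \<le> \<lceil>log 2 (real n)\<rceil> + 1)"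
proof -
  define K :: real where "K = 8 * exp 5 + 1"
  have K: "K \<ge> 0" by (simp add: K_def)
  define e where "e n = (ln (real n) / ln 2 + 2) * (K / (ln ((real n - 1) / 2))\<^sup>2)" for n
  obtain m0 where "\<forall>m\<ge>m0. \<forall>(V :: nat set) U p. finite U \<longrightarrow> card V = m \<longrightarrow> pairs V \<subseteq> U \<longrightarrow>
    (ln m + 4 * ln (ln m) + 192) / m \<le> p \<longrightarrow> p \<le> 1 \<longrightarrow>
    measure_pmf.prob (random_subset U p) {E. \<not> hamiltonian V E} \<le> K / (ln m)\<^sup>2"
    using prob_not_hamiltonian[where 'a = nat] unfolding eventually_sequentially K_def by (rule exE)
  note m0 = this[rule_format]
  \<comment> \<open>Halving n turns 12 ln ln n into 6 ln ln n; the surplus over the required 4 ln ln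
    n absorbs the constant 192 and the rounding of n / 2.\<close>
  have ev: "\<forall>\<^sub>F n in sequentially. (real n - 1) / 2 * (2 * ln (real n) + 12 * ln (ln (real n)))
      \<ge> real n * (ln (real n) + 4 * ln (ln (real n)) + 192)"
    "\<forall>\<^sub>F n in sequentially. 0 \<le> ln (real n) + 4 * ln (ln (real n)) + 192"
    "\<forall>\<^sub>F n in sequentially. 0 \<le> 2 * ln (real n) + 12 * ln (ln (real n))"
    by real_asymp+
  have "e \<longlonglongrightarrow> 0" unfolding e_def K_def by real_asymp
  moreover have "\<forall>\<^sub>F n in sequentially. measure_pmf.prob (gnp n (p n))
      {E. \<not> int (sp_star (vertices n) E) \<le> \<lceil>log 2 (real n)\<rceil> + 1} \<le> e n"
    using p dominates_lnln_ge[OF f, of 12] ev eventually_ge_at_top[of "2 * m0 + 9"]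
  proof eventually_elim
    case (elim n)
    define k where "k = nat \<lceil>log 2 (real n)\<rceil>"
    let ?U = "all_pairs n"
    let ?M = "random_subset ?U (p n)"
    have n: "n \<ge> 9" using elim by linarith
    have log0: "0 \<le> log 2 (real n)" using n by simp
    have k: "int k = \<lceil>log 2 (real n)\<rceil>" using log0 by (simp add: k_def)
    have "log 2 (real n) \<le> real k" by (simp add: k_def real_nat_ceiling_ge)
    then have "real n \<le> 2 powr real k" using n by (simp add: log_le_iff)
    then have "real n \<le> real (2 ^ k)" by (simp add: powr_realpow)
    then have nk: "n \<le> 2 ^ k" unfolding of_nat_le_iff .
    have "real k \<le> log 2 (real n) + 1" using k by linarith
    then have k_le: "real k + 1 \<le> ln (real n) / ln 2 + 2" by (simp add: log_def)
    have bound: "measure_pmf.prob ?M {E. \<not> hamiltonian V E} \<le> K / (ln ((real n - 1) / 2))\<^sup>2"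
      if V: "V \<subseteq> vertices n" "n \<le> 2 * card V + 1" "card V \<le> n" for V
    proof -
      let ?m = "real (card V)"
      have "real n \<le> real (2 * card V + 1)" using V(2) by (rule of_nat_mono)
      then have "(real n - 1) / 2 \<le> ?m" by simp
      \<comment> \<open>Since n is at least 2 m0 + 9, even a half has at least m0 + 4 vertices;
        having at least 4 makes its logarithm exceed 1, so that the iterated logarithm is monotone
        there.\<close>
      moreover have "m0 \<le> card V" "4 \<le> card V" using V(2) elim(6) by linarith+
      ultimately have m: "m0 \<le> card V" "?m \<ge> 4" "?m \<le> n" "(real n - 1) / 2 \<le> ?m"
        using V(3) by auto
      have "exp 1 < ?m" using m(2) exp_le by linarith
      then have "ln (exp 1) < ln ?m" using m(2) by (subst ln_less_cancel_iff) auto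
      then have ln1: "1 < ln ?m" by simp
      have "pairs V \<subseteq> ?U" using V(1) by (auto simp: all_pairs_eq pairs_def)
      moreover have "(ln ?m + 4 * ln (ln ?m) + 192) / ?m \<le> p n"
      proof -
        let ?g = "ln ?m + 4 * ln (ln ?m) + 192"
        have "?g \<le> ln (real n) + 4 * ln (ln (real n)) + 192"
          using m ln1 by (intro add_mono mult_left_mono ln_mono) auto
        then have "real n * ?g \<le> real n * (ln (real n) + 4 * ln (ln (real n)) + 192)"
          by (intro mult_left_mono) auto
        also have "\<dots> \<le> (real n - 1) / 2 * (2 * ln (real n) + 12 * ln (ln (real n)))"
          using elim by simp
        also have "\<dots> \<le> ?m * (2 * ln (real n) + f n)"
          using m elim n by (intro mult_mono) auto
        finally have "?g / ?m \<le> (2 * ln (real n) + f n) / real n"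
          using m n by (simp add: divide_simps mult_ac)
        then show ?thesis using elim by linarith
      qed
      ultimately have "measure_pmf.prob ?M {E. \<not> hamiltonian V E} \<le> K / (ln ?m)\<^sup>2"
        using m(1) p_prob finite_all_pairs by (intro m0[of "card V" ?U V]) auto
      also have "\<dots> \<le> K / (ln ((real n - 1) / 2))\<^sup>2"
      proof -
        have "0 < ln ((real n - 1) / 2)" using n by simp
        moreover have "ln ((real n - 1) / 2) \<le> ln ?m" using m(4) n by (intro ln_mono) auto
        ultimately show ?thesis using K by (intro divide_left_mono power_mono mult_pos_pos) auto
      qed
      finally show ?thesis .
    qed
    let ?B = "\<lambda>V. {E. \<not> hamiltonian V E}"
    have "{E. \<not> int (sp_star (vertices n) E) \<le> \<lceil>log 2 (real n)\<rceil> + 1}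
        \<subseteq> ?B (vertices n) \<union> (\<Union>i<k. ?B (code_set n i))"
    proof
      fix E assume "E \<in> {E. \<not> int (sp_star (vertices n) E) \<le> \<lceil>log 2 (real n)\<rceil> + 1}"
      then have "\<not> sp_star (vertices n) E \<le> k + 1" unfolding mem_Collect_eq k[symmetric] by linarith
      then show "E \<in> ?B (vertices n) \<union> (\<Union>i<k. ?B (code_set n i))"
        using sp_star_le[OF nk, of E] by blast
    qed
    then have "measure_pmf.prob ?M {E. \<not> int (sp_star (vertices n) E) \<le> \<lceil>log 2 (real n)\<rceil> + 1}
        \<le> measure_pmf.prob ?M (?B (vertices n) \<union> (\<Union>i<k. ?B (code_set n i)))"
      by (intro measure_pmf.finite_measure_mono) auto
    also have "\<dots> \<le> measure_pmf.prob ?M (?B (vertices n)) + measure_pmf.prob ?M (\<Union>i<k. ?B (code_set n i))"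
      by (intro measure_Un_le) auto
    also have "measure_pmf.prob ?M (\<Union>i<k. ?B (code_set n i)) \<le> (\<Sum>i<k. measure_pmf.prob ?M (?B (code_set n i)))"
      by (intro measure_pmf.finite_measure_subadditive_finite) auto
    also have "\<dots> \<le> (\<Sum>i<k. K / (ln ((real n - 1) / 2))\<^sup>2)"
      by (intro sum_mono bound card_code_set) (auto simp: code_set_def vertices_def)
    also have "measure_pmf.prob ?M (?B (vertices n)) \<le> K / (ln ((real n - 1) / 2))\<^sup>2"
      by (intro bound) (auto simp: vertices_def)
    also have "K / (ln ((real n - 1) / 2))\<^sup>2 + (\<Sum>i<k. K / (ln ((real n - 1) / 2))\<^sup>2)
        = (real k + 1) * (K / (ln ((real n - 1) / 2))\<^sup>2)"
      by (simp add: algebra_simps add_divide_distrib)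
    also have "\<dots> \<le> e n" unfolding e_def using k_le K by (intro mult_right_mono) auto
    finally show ?case by (simp add: gnp_eq_random_subset)
  qed
  ultimately show ?thesis by (intro whpI) auto
qed

text \<open>Already the density \<open>q\<close>, with 3 ln ln n below ln n, leaves about (ln n)^3
  isolated vertices on average. Smaller densities leave at least as many, and half of the mean
  exceeds (ln n)^2 + 1.\<close>

lemma lower_bound:
  assumes p_prob: "\<And>n. 0 \<le> p n \<and> p n \<le> 1"
    and f: "dominates f (\<lambda>n. ln (ln (real n)))"
    and p: "\<forall>\<^sub>F n in sequentially. p n \<le> (ln (real n) - f n) / real n"
  shows "whp (\<lambda>n. gnp n (p n)) (\<lambda>n E. real (sp (vertices n) E) \<ge> (ln (real n))\<^sup>2)"
proof -
  define q where "q x = (ln x - 3 * ln (ln x)) / x" for x :: real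
  define e where "e n = 8 / ln (real n) ^ 3 + 4 * q n / (1 - q n)" for n
  \<comment> \<open>The mean at density \<open>q\<close> is asymptotically (ln n)^3; half of that is
    used as a lower bound for \<open>\<mu>\<close>, and Chebyshev loses another factor 2, which
    gives the quarter.\<close>
  have ev: "\<forall>\<^sub>F n in sequentially. real n * (1 - q n) powr real n \<ge> ln (real n) ^ 3 / 2"
    "\<forall>\<^sub>F n in sequentially. q n \<le> 1 / 2"
    "\<forall>\<^sub>F n in sequentially. ln (real n) ^ 3 / 4 - 1 \<ge> (ln (real n))\<^sup>2"
    "\<forall>\<^sub>F n in sequentially. ln (real n) > 0"
    unfolding q_def by real_asymp+
  have "e \<longlonglongrightarrow> 0" unfolding e_def q_def by real_asymp
  moreover have "\<forall>\<^sub>F n in sequentially. measure_pmf.prob (gnp n (p n))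
      {E. \<not> real (sp (vertices n) E) \<ge> (ln (real n))\<^sup>2} \<le> e n"
    using p dominates_lnln_ge[OF f, of 3] ev eventually_gt_at_top[of 0]
  proof eventually_elim
    case (elim n)
    define \<mu> where "\<mu> = real n * (1 - p n) ^ (n - 1)"
    have "p n \<le> (ln (real n) - f n) / real n" using elim by simp
    also have "\<dots> \<le> q n" unfolding q_def using elim by (intro divide_right_mono) auto
    finally have pq: "p n \<le> q n" .
    have p01: "0 \<le> p n" "p n < 1" using p_prob[of n] pq elim by linarith+
    have V: "finite (vertices n)" "vertices n \<noteq> {}" "card (vertices n) = n"
      using elim by (auto simp: vertices_def)
    have "ln (real n) ^ 3 / 2 \<le> real n * (1 - q n) ^ n"
      using elim by (simp add: powr_realpow)
    also have "\<dots> \<le> real n * (1 - p n) ^ n"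
      using pq elim by (intro mult_left_mono power_mono) auto
    also have "\<dots> \<le> \<mu>"
      unfolding \<mu>_def using p01 by (intro mult_left_mono power_decreasing) auto
    finally have \<mu>: "ln (real n) ^ 3 / 2 \<le> \<mu>" .
    have "{E. \<not> real (sp (vertices n) E) \<ge> (ln (real n))\<^sup>2}
        \<subseteq> {E. real (card (isolated (vertices n) E)) \<le> \<mu> / 2}"
    proof
      fix E assume "E \<in> {E. \<not> real (sp (vertices n) E) \<ge> (ln (real n))\<^sup>2}"
      then have "real (sp (vertices n) E) < (ln (real n))\<^sup>2" by simp
      moreover have "real (card (isolated (vertices n) E)) \<le> real (sp (vertices n) E + 1)"
        using card_isolated_le_sp[OF V(1)] by (rule of_nat_mono)
      moreover have "(ln (real n))\<^sup>2 \<le> ln (real n) ^ 3 / 4 - 1" using elim by simp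
      ultimately show "E \<in> {E. real (card (isolated (vertices n) E)) \<le> \<mu> / 2}" using \<mu> by simp
    qed
    then have "measure_pmf.prob (gnp n (p n)) {E. \<not> real (sp (vertices n) E) \<ge> (ln (real n))\<^sup>2}
        \<le> measure_pmf.prob (gnp n (p n)) {E. real (card (isolated (vertices n) E)) \<le> \<mu> / 2}"
      by (intro measure_pmf.finite_measure_mono) auto
    also have "\<dots> \<le> 4 / \<mu> + 4 * p n / (1 - p n)"
      using prob_few_isolated[OF V(1,2) p01] by (simp add: V(3) \<mu>_def gnp_eq_random_subset all_pairs_eq)
    also have "\<dots> \<le> 4 / (ln (real n) ^ 3 / 2) + 4 * q n / (1 - q n)"
    proof (intro add_mono)
      have pos: "0 < ln (real n) ^ 3 / 2" using elim by simp
      then have "0 < \<mu>" using \<mu> by linarith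
      with pos show "4 / \<mu> \<le> 4 / (ln (real n) ^ 3 / 2)"
        using \<mu> by (intro divide_left_mono mult_pos_pos) auto
      show "4 * p n / (1 - p n) \<le> 4 * q n / (1 - q n)"
        using pq p01 elim by (intro frac_le) auto
    qed
    finally show ?case by (simp add: e_def)
  qed
  ultimately show ?thesis by (intro whpI) auto
qed

theorem theorem3p5:
  fixes p :: "nat \<Rightarrow> real"
  assumes p_prob: "\<And>n. 0 \<le> p n \<and> p n \<le> 1"
  shows
    "((\<exists>f. dominates f (\<lambda>n. ln (ln (real n))) \<and>
          (\<forall>\<^sub>F n in sequentially. p n \<ge> (2 * ln (real n) + f n) / real n))
      \<longrightarrow> whp (\<lambda>n. gnp n (p n))
            (\<lambda>n E. int (sp_star (vertices n) E) \<le> \<lceil>log 2 (real n)\<rceil> + 1))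
     \<and>
     ((\<exists>f. dominates f (\<lambda>n. ln (ln (real n))) \<and>
          (\<forall>\<^sub>F n in sequentially. p n \<le> (ln (real n) - f n) / real n))
      \<longrightarrow> (\<exists>g. dominates g (\<lambda>n. ln (real n)) \<and>
            whp (\<lambda>n. gnp n (p n)) (\<lambda>n E. real (sp (vertices n) E) \<ge> g n)))"
proof (intro conjI impI)
  \<comment> \<open>The witness for \<open>g\<close> is (ln n)^2, whose ratio to ln n is ln n and
    tends to infinity.\<close>
  have "dominates (\<lambda>n. (ln (real n))\<^sup>2) (\<lambda>n. ln (real n))"
    unfolding dominates_def by real_asymp
  then show "\<exists>g. dominates g (\<lambda>n. ln (real n)) \<and>
      whp (\<lambda>n. gnp n (p n)) (\<lambda>n E. real (sp (vertices n) E) \<ge> g n)"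
    if "\<exists>f. dominates f (\<lambda>n. ln (ln (real n))) \<and>
      (\<forall>\<^sub>F n in sequentially. p n \<le> (ln (real n) - f n) / real n)"
    using that lower_bound[of p, OF p_prob] by blast
qed (use upper_bound[of p, OF p_prob] in blast)

end
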